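(* Let $X\subset\mathbb{R}^n$ be closed, bounded and convex. Let $F(x)=\mathbb{E}[\Phi(x,\xi)]$ be monotone and continuous on $X^\epsilon$, suppose there is $C>0$ with $\mathbb{E}[\|\Phi(x,\xi)\|^2]\le C^2$ for all $x\in X^\epsilon$, and suppose the solution set of VI$(X,F)$ is nonempty. Let $t^*$ be the least-norm solution of VI$(X,F)$, and assume that $F$ is differentiable at $t^*$ and its Jacobian is bounded in a neighborhood of $t^*$. Let $\gamma_k=\gamma_0(k+1)^{-a}$, $\eta_k=\eta_0(k+1)^{-b}$, $\epsilon_k=\epsilon_0(k+1)^{-c}$ with positive constants $\gamma_0,\eta_0,\epsilon_0$. Let $\xi_0,\xi_1,\dots$ be i.i.d. copies of $\xi$, let $z_0,z_1,\dots$ be independent with $z_k$ uniform on $B_n(0,\epsilon_k)$, and let $x_0$, $(\xi_j)$, $(z_i)$ be mutually independent. Let $\{\bar x_k(r)\}$ be generated by the aRSSA$_r$ algorithm. Then for any given $0<\delta<\frac16$ there exist $a,b,c,r$ satisfying $$a,b,c>0,\quad a>0.5,\quad a+3b<1,\quad b+2c<a,\quad b<c,\quad r\le\frac1a$$ for which $\mathbb{E}[\mathrm{G}(\bar x_k(r))]=\mathcal{O}\big(k^{-(\frac16-\delta)}\big)$. More precisely, if $0<\delta<\frac16$, $0<\delta'<\delta$, $a=0.5+3(\delta-\delta')$, $b=\frac16-\delta$, $c=\frac16$ and $r<\frac{0.5-3(\delta-\delta')}{0.5+3(\delta-\delta')}$, then $\mathbb{E}[\mathrm{G}(\bar x_k(r))]$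 converges to zero with order $\mathcal{O}\big(k^{-(\frac16-\delta)}\big)$.
   Context: $\|\cdot\|$ is the Euclidean norm, $B_n(y,\rho)=\{x\in\mathbb{R}^n:\|x-y\|\le\rho\}$, $\Pi_X$ is Euclidean projection onto $X$. $\epsilon>0$ is a fixed upper bound of $\{\epsilon_k\}$ and $X^\epsilon=X+B_n(0,\epsilon)$. $\xi$ is an $\mathbb{R}^d$-valued random vector, $\Phi:X^\epsilon\times\mathbb{R}^d\to\mathbb{R}^n$. VI$(X,F)$ asks for $x^*\in X$ with $F(x^* )^T(x-x^* )\ge0$ for all $x\in X$. aRSSA$_r$ algorithm ($r\in\mathbb{R}$): $x_0\in X$ is a random vector with $\mathbb{E}[\|x_0\|^2]<\infty$, and for $k\ge0$, $x_{k+1}=\Pi_X\big(x_k-\gamma_k(\Phi(x_k+z_k,\xi_k)+\eta_kx_k)\big)$, $\ \bar x_{k+1}(r)=\frac{\sum_{t=0}^k\gamma_t^rx_t}{\sum_{t=0}^k\gamma_t^r}$. Gap function: $\mathrm{G}(x)=\sup_{y\in X}F(y)^T(x-y)$ for $x\in X$. *)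

theory Defs
  imports "HOL-Probability.Probability" "HOL-Library.Landau_Symbols" "HOL-Library.Set_Algebras"
begin

definition monotone_map_on :: "'a::real_inner set \<Rightarrow> ('a \<Rightarrow> 'a) \<Rightarrow> bool" where
  "monotone_map_on S F \<longleftrightarrow> (\<forall>x\<in>S. \<forall>y\<in>S. (F x - F y) \<bullet> (x - y) \<ge> 0)"

definition VI_solutions :: "'a::real_inner set \<Rightarrow> ('a \<Rightarrow> 'a) \<Rightarrow> 'a set" where
  "VI_solutions X F = {x \<in> X. \<forall>y\<in>X. F x \<bullet> (y - x) \<ge> 0}"

(* Real-valued supremum: it is the true supremum when X is nonempty and F is bounded on
   the bounded set X, e.g. when X is compact and F is continuous on X. *)
definition gap :: "'a::real_inner set \<Rightarrow> ('a \<Rightarrow> 'a) \<Rightarrow> 'a \<Rightarrow> real" where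
  "gap X F x = (SUP y\<in>X. F y \<bullet> (x - y))"

definition power_seq :: "real \<Rightarrow> real \<Rightarrow> nat \<Rightarrow> real" where
  "power_seq s p k = s * (real k + 1) powr (- p)"

(* Recursion along one realization x0, u, z of the starting point, the samples of the
   random vector and the perturbations; closest_point X is the Euclidean projection. *)
primrec aRSSA_iterate ::
  "'a::euclidean_space set \<Rightarrow> ('a \<Rightarrow> 'b \<Rightarrow> 'a) \<Rightarrow> (nat \<Rightarrow> real) \<Rightarrow> (nat \<Rightarrow> real) \<Rightarrow>
   'a \<Rightarrow> (nat \<Rightarrow> 'b) \<Rightarrow> (nat \<Rightarrow> 'a) \<Rightarrow> nat \<Rightarrow> 'a" where
  "aRSSA_iterate X \<Phi> \<gamma> \<eta> x0 u z 0 = x0"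
| "aRSSA_iterate X \<Phi> \<gamma> \<eta> x0 u z (Suc k) =
     (let x = aRSSA_iterate X \<Phi> \<gamma> \<eta> x0 u z k
      in closest_point X (x - \<gamma> k *\<^sub>R (\<Phi> (x + z k) (u k) + \<eta> k *\<^sub>R x)))"

(* The average with index k runs over t < k; it is meaningful for k > 0 and is 0 for k = 0. *)
definition weighted_average ::
  "(nat \<Rightarrow> real) \<Rightarrow> real \<Rightarrow> (nat \<Rightarrow> 'a::real_vector) \<Rightarrow> nat \<Rightarrow> 'a" where
  "weighted_average \<gamma> r x k =
     (\<Sum>t<k. (\<gamma> t powr r) *\<^sub>R x t) /\<^sub>R (\<Sum>t<k. \<gamma> t powr r)"

definition aRSSA_average ::
  "'a::euclidean_space set \<Rightarrow> ('a \<Rightarrow> 'b \<Rightarrow> 'a) \<Rightarrow> (nat \<Rightarrow> real) \<Rightarrow> (nat \<Rightarrow> real) \<Rightarrow> real \<Rightarrow>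
   ('s \<Rightarrow> 'a) \<Rightarrow> (nat \<Rightarrow> 's \<Rightarrow> 'b) \<Rightarrow> (nat \<Rightarrow> 's \<Rightarrow> 'a) \<Rightarrow> nat \<Rightarrow> 's \<Rightarrow> 'a" where
  "aRSSA_average X \<Phi> \<gamma> \<eta> r x0 \<xi>s z k \<omega> =
     weighted_average \<gamma> r
       (aRSSA_iterate X \<Phi> \<gamma> \<eta> (x0 \<omega>) (\<lambda>j. \<xi>s j \<omega>) (\<lambda>i. z i \<omega>)) k"

(* The last conjunct is the mutual independence of the sigma-algebras generated by x0, by the
   whole family (\<xi>s j)_j and by the whole family (z i)_i; pairwise independence of the
   three would not be enough. *)
definition aRSSA_inputs ::
  "'s measure \<Rightarrow> 'a::euclidean_space set \<Rightarrow> ('s \<Rightarrow> 'b::euclidean_space) \<Rightarrow> (nat \<Rightarrow> real) \<Rightarrow>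
   ('s \<Rightarrow> 'a) \<Rightarrow> (nat \<Rightarrow> 's \<Rightarrow> 'b) \<Rightarrow> (nat \<Rightarrow> 's \<Rightarrow> 'a) \<Rightarrow> bool" where
  "aRSSA_inputs M X \<xi> eps x0 \<xi>s z \<longleftrightarrow>
     x0 \<in> borel_measurable M \<and> (AE \<omega> in M. x0 \<omega> \<in> X) \<and>
     integrable M (\<lambda>\<omega>. (norm (x0 \<omega>))\<^sup>2) \<and>
     prob_space.indep_vars M (\<lambda>_. borel) \<xi>s UNIV \<and>
     (\<forall>k. distr M borel (\<xi>s k) = distr M borel \<xi>) \<and>
     prob_space.indep_vars M (\<lambda>_. borel) z UNIV \<and>
     (\<forall>k. distr M borel (z k) = uniform_measure lborel (cball 0 (eps k))) \<and>
     prob_space.indep_sets M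
       (\<lambda>i. [sets (vimage_algebra (space M) x0 borel),
             sets (vimage_algebra (space M) (\<lambda>\<omega> j. \<xi>s j \<omega>) (PiM UNIV (\<lambda>_. borel))),
             sets (vimage_algebra (space M) (\<lambda>\<omega> i. z i \<omega>) (PiM UNIV (\<lambda>_. borel)))] ! i)
       {..<3::nat}"

end

theory Submission
  imports Defs
begin

text \<open>
  The averaged iterates are analysed directly against an arbitrary \<open>y \<in> X\<close>: since the projection is
  nonexpansive and the weights \<open>\<gamma>\<^sub>t\<^sup>r\<^sup>-\<^sup>1\<close> increase, \<open>\<Sum> \<gamma>\<^sub>t\<^sup>r g\<^sub>t \<bullet> (x\<^sub>t - y)\<close> is at most
  \<open>\<gamma>\<^sub>k\<^sup>r\<^sup>-\<^sup>1 D\<^sup>2/2 + \<Sum> \<gamma>\<^sub>t\<^sup>r\<^sup>+\<^sup>1 \<parallel>g\<^sub>t\<parallel>\<^sup>2/2\<close>, where \<open>g\<^sub>t\<close> is the step direction. Monotonicity at the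
  perturbed point \<open>x\<^sub>t + z\<^sub>t\<close> replaces \<open>F (x\<^sub>t + z\<^sub>t)\<close> by \<open>F y\<close> at a cost of order \<open>\<epsilon>\<^sub>t\<close>, and the regularization
  costs order \<open>\<eta>\<^sub>t\<close>. After division by \<open>\<Sum> \<gamma>\<^sub>t\<^sup>r\<close> the four error terms are of order \<open>k\<^sup>a\<^sup>-\<^sup>1\<close>, \<open>k\<^sup>-\<^sup>a\<close>,
  \<open>k\<^sup>-\<^sup>b\<close> and \<open>k\<^sup>-\<^sup>c\<close>, and \<open>k\<^sup>-\<^sup>b\<close> dominates.
\<close>

subsection \<open>Regret of projected steps\<close>

text \<open>This is summation by parts as an induction: the slack \<open>B - d (Suc n)\<close> is
  nonnegative, so raising its weight from \<open>\<beta> n\<close> to \<open>\<beta> (Suc n)\<close>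
  keeps the bound valid and lets the next difference telescope.\<close>

lemma weighted_telescope_le:
  fixes \<beta> d :: "nat \<Rightarrow> real"
  assumes "\<And>n. 0 \<le> \<beta> n" "\<And>n. \<beta> n \<le> \<beta> (Suc n)" "\<And>n. d n \<le> B"
  shows "(\<Sum>t<Suc n. \<beta> t * (d t - d (Suc t))) \<le> \<beta> n * (B - d (Suc n))"
proof (induction n)
  case 0
  show ?case using assms(1)[of 0] assms(3)[of 0] by (simp add: mult_left_mono)
next
  case (Suc n)
  have "\<beta> n * (B - d (Suc n)) \<le> \<beta> (Suc n) * (B - d (Suc n))"
    using assms(2)[of n] assms(3)[of "Suc n"] by (intro mult_right_mono) auto
  with Suc show ?case by (simp add: algebra_simps)
qed

text \<open>Projection onto \<open>X\<close> is nonexpansive and fixes \<open>y\<close>, so it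
  suffices to expand the square for the unprojected step.\<close>

lemma projected_step_le:
  fixes x y g :: "'a::euclidean_space"
  assumes "convex X" "closed X" "y \<in> X"
  shows "2 * \<gamma> * (g \<bullet> (x - y)) \<le>
    (norm (x - y))\<^sup>2 - (norm (closest_point X (x - \<gamma> *\<^sub>R g) - y))\<^sup>2 + \<gamma>\<^sup>2 * (norm g)\<^sup>2"
proof -
  have "norm (closest_point X (x - \<gamma> *\<^sub>R g) - y) \<le> norm (x - \<gamma> *\<^sub>R g - y)"
    using closest_point_lipschitz[of X "x - \<gamma> *\<^sub>R g" y] assms closest_point_self[of y X]
    by (auto simp: dist_norm)
  then have "(norm (closest_point X (x - \<gamma> *\<^sub>R g) - y))\<^sup>2 \<le> (norm (x - \<gamma> *\<^sub>R g - y))\<^sup>2"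
    by (simp add: power_mono)
  also have "\<dots> = (norm (x - y))\<^sup>2 - 2 * \<gamma> * (g \<bullet> (x - y)) + \<gamma>\<^sup>2 * (norm g)\<^sup>2"
    unfolding power2_norm_eq_inner
    by (simp add: inner_diff_left inner_diff_right inner_commute algebra_simps power2_eq_square)
  finally show ?thesis by simp
qed

text \<open>The directions \<open>g\<close> form an arbitrary given sequence. The algorithm and the
  noise-driven comparison sequence are then both instances, and one regret bound serves
  them.\<close>

primrec projected_iterate ::
  "'a::euclidean_space set \<Rightarrow> (nat \<Rightarrow> real) \<Rightarrow> 'a \<Rightarrow> (nat \<Rightarrow> 'a) \<Rightarrow> nat \<Rightarrow> 'a" where
  "projected_iterate X \<gamma> x g 0 = x"
| "projected_iterate X \<gamma> x g (Suc k) =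
     closest_point X (projected_iterate X \<gamma> x g k - \<gamma> k *\<^sub>R g k)"

lemma projected_iterate_in:
  assumes "closed X" "X \<noteq> {}" "x \<in> X"
  shows "projected_iterate X \<gamma> x g k \<in> X"
  using assms by (cases k) (auto intro: closest_point_in_set)

text \<open>The directions on the right mention the iterates themselves; this is harmless because
  the iterate at \<open>k\<close> reads only directions with index below \<open>k\<close>.\<close>

lemma aRSSA_iterate_eq_projected_iterate:
  "aRSSA_iterate X \<Phi> \<gamma> \<eta> x0 u z k =
   projected_iterate X \<gamma> x0
     (\<lambda>t. \<Phi> (aRSSA_iterate X \<Phi> \<gamma> \<eta> x0 u z t + z t) (u t) + \<eta> t *\<^sub>R aRSSA_iterate X \<Phi> \<gamma> \<eta> x0 u z t) k"
  by (induction k) (simp_all add: Let_def)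

text \<open>Multiplying the one-step inequality by \<open>\<gamma> t powr (r - 1)\<close> produces
  the weights \<open>r\<close> and \<open>r + 1\<close>. Since \<open>\<gamma>\<close> decreases and
  \<open>r \<le> 1\<close>, these multipliers increase, so the distance terms telescope with
  weights.\<close>

lemma projected_iterate_regret:
  fixes x y :: "'a::euclidean_space"
  assumes X: "convex X" "closed X" "X \<noteq> {}" "x \<in> X" "y \<in> X"
    and diam: "\<And>u v. u \<in> X \<Longrightarrow> v \<in> X \<Longrightarrow> norm (u - v) \<le> D"
    and \<gamma>: "\<And>n. 0 < \<gamma> n" "\<And>n. \<gamma> (Suc n) \<le> \<gamma> n" and r: "r \<le> 1"
  shows "(\<Sum>t<Suc n. \<gamma> t powr r * (g t \<bullet> (projected_iterate X \<gamma> x g t - y))) \<le>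
    (\<gamma> n powr (r - 1) * D\<^sup>2 + (\<Sum>t<Suc n. \<gamma> t powr (r + 1) * (norm (g t))\<^sup>2)) / 2"
proof -
  define p where "p = projected_iterate X \<gamma> x g"
  define d where "d t = (norm (p t - y))\<^sup>2" for t
  have pX: "p t \<in> X" for t unfolding p_def by (rule projected_iterate_in[OF X(2-4)])
  have d: "0 \<le> d t" "d t \<le> D\<^sup>2" for t
    unfolding d_def using diam[OF pX X(5), of t] by (auto intro: power_mono)
  have step: "2 * (\<gamma> t powr r * (g t \<bullet> (p t - y))) \<le>
      \<gamma> t powr (r - 1) * (d t - d (Suc t)) + \<gamma> t powr (r + 1) * (norm (g t))\<^sup>2" for t
  proof -
    have e: "\<gamma> t powr r = \<gamma> t powr (r - 1) * \<gamma> t" "\<gamma> t powr (r + 1) = \<gamma> t powr (r - 1) * (\<gamma> t)\<^sup>2"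
      using \<gamma>(1)[of t] powr_add[of "\<gamma> t" "r - 1" 1] powr_add[of "\<gamma> t" "r - 1" 2]
      by (simp_all add: algebra_simps)
    have "2 * \<gamma> t * (g t \<bullet> (p t - y)) \<le> d t - d (Suc t) + (\<gamma> t)\<^sup>2 * (norm (g t))\<^sup>2"
      unfolding d_def p_def using projected_step_le[OF X(1,2,5)] by simp
    then have "\<gamma> t powr (r - 1) * (2 * \<gamma> t * (g t \<bullet> (p t - y))) \<le>
        \<gamma> t powr (r - 1) * (d t - d (Suc t) + (\<gamma> t)\<^sup>2 * (norm (g t))\<^sup>2)"
      by (rule mult_left_mono) simp
    then show ?thesis unfolding e by (simp add: algebra_simps)
  qed
  have "2 * (\<Sum>t<Suc n. \<gamma> t powr r * (g t \<bullet> (p t - y))) \<le>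
      (\<Sum>t<Suc n. \<gamma> t powr (r - 1) * (d t - d (Suc t)) + \<gamma> t powr (r + 1) * (norm (g t))\<^sup>2)"
    unfolding sum_distrib_left by (intro sum_mono step)
  also have "\<dots> = (\<Sum>t<Suc n. \<gamma> t powr (r - 1) * (d t - d (Suc t))) +
      (\<Sum>t<Suc n. \<gamma> t powr (r + 1) * (norm (g t))\<^sup>2)"
    by (rule sum.distrib)
  also have "(\<Sum>t<Suc n. \<gamma> t powr (r - 1) * (d t - d (Suc t))) \<le> \<gamma> n powr (r - 1) * (D\<^sup>2 - d (Suc n))"
  proof (rule weighted_telescope_le)
    show "\<gamma> k powr (r - 1) \<le> \<gamma> (Suc k) powr (r - 1)" for k
      using \<gamma>(1)[of "Suc k"] \<gamma>(2)[of k] r by (intro powr_mono2') auto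
  qed (use d in auto)
  also have "\<dots> \<le> \<gamma> n powr (r - 1) * D\<^sup>2"
    using d(1)[of "Suc n"] by (intro mult_left_mono) auto
  finally show ?thesis unfolding p_def by simp
qed

subsection \<open>The gap function along a realization\<close>

text \<open>The real supremum in \<open>gap\<close> behaves as a least upper bound only for a
  bounded family; this supplies the side condition of every use of
  \<open>cSUP_upper\<close>.\<close>

lemma gap_bdd_above:
  assumes "\<And>y. y \<in> X \<Longrightarrow> norm (F y) \<le> C" "\<And>y. y \<in> X \<Longrightarrow> norm y \<le> R"
  shows "bdd_above ((\<lambda>y. F y \<bullet> (x - y)) ` X)"
proof (rule bdd_aboveI2)
  fix y assume y: "y \<in> X"
  have "F y \<bullet> (x - y) \<le> norm (F y) * norm (x - y)" by (rule norm_cauchy_schwarz)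
  also have "\<dots> \<le> C * (norm x + R)"
    using assms[OF y] norm_triangle_ineq4[of x y]
    by (intro mult_mono) (auto intro: order_trans[OF norm_ge_zero])
  finally show "F y \<bullet> (x - y) \<le> C * (norm x + R)" .
qed

text \<open>\<open>gap X F\<close> is a supremum of affine functions whose slopes \<open>F y\<close>
  have norm at most \<open>C\<close>. The resulting continuity gives measurability of the gap at a
  random point.\<close>

lemma gap_lipschitz:
  assumes X: "X \<noteq> {}" and F: "\<And>y. y \<in> X \<Longrightarrow> norm (F y) \<le> C" "\<And>y. y \<in> X \<Longrightarrow> norm y \<le> R"
  shows "C-lipschitz_on UNIV (gap X F)"
proof -
  have C: "0 \<le> C" using X F(1) order_trans[OF norm_ge_zero] by blast
  have le: "gap X F x \<le> gap X F x' + C * dist x x'" for x x'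
    unfolding gap_def
  proof (rule cSUP_least[OF X])
    fix y assume y: "y \<in> X"
    have "F y \<bullet> (x - y) = F y \<bullet> (x' - y) + F y \<bullet> (x - x')" by (simp add: inner_diff_right)
    also have "F y \<bullet> (x' - y) \<le> (SUP y\<in>X. F y \<bullet> (x' - y))"
      by (rule cSUP_upper[OF y gap_bdd_above[OF F]])
    also have "F y \<bullet> (x - x') \<le> norm (F y) * norm (x - x')" by (rule norm_cauchy_schwarz)
    also have "\<dots> \<le> C * dist x x'" unfolding dist_norm using F(1)[OF y] by (rule mult_right_mono) simp
    finally show "F y \<bullet> (x - y) \<le> (SUP y\<in>X. F y \<bullet> (x' - y)) + C * dist x x'" by simp
  qed
  show ?thesis
  proof (rule lipschitz_onI[OF _ C])
    fix x x' show "dist (gap X F x) (gap X F x') \<le> C * dist x x'"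
      using le[of x x'] le[of x' x] by (simp add: dist_real_def dist_commute abs_le_iff)
  qed
qed

text \<open>The lower bound comes from the choice \<open>y = x\<close>; the upper one is
  Cauchy-Schwarz, with \<open>2 * R\<close> bounding the diameter of \<open>X\<close>.\<close>

lemma gap_bounds:
  assumes F: "\<And>y. y \<in> X \<Longrightarrow> norm (F y) \<le> C" "\<And>y. y \<in> X \<Longrightarrow> norm y \<le> R" and x: "x \<in> X"
  shows "0 \<le> gap X F x" "gap X F x \<le> C * (2 * R)"
proof -
  have "F x \<bullet> (x - x) \<le> gap X F x"
    unfolding gap_def by (rule cSUP_upper[OF x gap_bdd_above[OF F]])
  then show "0 \<le> gap X F x" by simp
  show "gap X F x \<le> C * (2 * R)"
    unfolding gap_def
  proof (rule cSUP_least)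
    fix y assume y: "y \<in> X"
    have "F y \<bullet> (x - y) \<le> norm (F y) * norm (x - y)" by (rule norm_cauchy_schwarz)
    also have "\<dots> \<le> C * (2 * R)"
      using F(1)[OF y] F(2)[OF y] F(2)[OF x] norm_triangle_ineq4[of x y]
      by (intro mult_mono) (auto intro: order_trans[OF norm_ge_zero])
    finally show "F y \<bullet> (x - y) \<le> C * (2 * R)" .
  qed (use x in auto)
qed

text \<open>For fixed \<open>y\<close> the pairing is affine in \<open>x\<close>, so it commutes
  with the average. As \<open>B\<close> is uniform in \<open>y\<close>, the bound survives the
  supremum.\<close>

lemma gap_weighted_average_le:
  assumes "X \<noteq> {}" and W: "0 < (\<Sum>t<k. \<gamma> t powr r)"
    and B: "\<And>y. y \<in> X \<Longrightarrow> (\<Sum>t<k. \<gamma> t powr r * (F y \<bullet> (x t - y))) \<le> B"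
  shows "gap X F (weighted_average \<gamma> r x k) \<le> B / (\<Sum>t<k. \<gamma> t powr r)"
  unfolding gap_def
proof (rule cSUP_least[OF assms(1)])
  fix y assume y: "y \<in> X"
  let ?W = "\<Sum>t<k. \<gamma> t powr r"
  have "?W *\<^sub>R (weighted_average \<gamma> r x k - y) = (\<Sum>t<k. (\<gamma> t powr r) *\<^sub>R (x t - y))"
    using W by (simp add: weighted_average_def scaleR_diff_right sum_subtractf scaleR_sum_left)
  then have "?W * (F y \<bullet> (weighted_average \<gamma> r x k - y)) = (\<Sum>t<k. \<gamma> t powr r * (F y \<bullet> (x t - y)))"
    by (metis (no_types, lifting) inner_scaleR_right inner_sum_right sum.cong)
  with B[OF y] show "F y \<bullet> (weighted_average \<gamma> r x k - y) \<le> B / ?W"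
    using W by (simp add: field_simps)
qed

lemma weighted_average_in:
  assumes "convex X" "\<And>t. x t \<in> X" "0 < (\<Sum>t<k. \<gamma> t powr r)"
  shows "weighted_average \<gamma> r x k \<in> X"
proof -
  have "weighted_average \<gamma> r x k = (\<Sum>t<k. (\<gamma> t powr r / (\<Sum>t<k. \<gamma> t powr r)) *\<^sub>R x t)"
    by (simp add: weighted_average_def scaleR_sum_right field_simps)
  also have "\<dots> \<in> X"
    using assms by (intro convex_sum) (auto simp: sum_divide_distrib[symmetric] less_imp_le intro!: divide_nonneg_pos)
  finally show ?thesis .
qed

text \<open>\<open>u\<close> is a virtual iterate driven by the noise \<open>w\<close> alone. It moves the dependence on the
  comparison point \<open>y\<close> out of the noise term: what remains is \<open>w t \<bullet> (x t - u t)\<close>, whose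
  expectation vanishes, so that the supremum over \<open>y\<close> may be taken before the expectation.\<close>

lemma pathwise_regret:
  fixes F :: "'a::euclidean_space \<Rightarrow> 'a" and x0 :: 'a
  assumes X: "convex X" "closed X" "x0 \<in> X" "y \<in> X"
    and R: "\<And>v. v \<in> X \<Longrightarrow> norm v \<le> R"
    and C: "\<And>v. v \<in> X + cball 0 \<epsilon> \<Longrightarrow> norm (F v) \<le> C"
    and mono: "monotone_map_on (X + cball 0 \<epsilon>) F"
    and \<gamma>: "\<And>n. 0 < \<gamma> n" "\<And>n. \<gamma> (Suc n) \<le> \<gamma> n" and r: "r \<le> 1"
    and \<eta>: "\<And>t. 0 \<le> \<eta> t" "\<And>t. \<eta> t \<le> H"
    and z: "\<And>t. norm (z t) \<le> eps t" "\<And>t. eps t \<le> \<epsilon>"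
    and x: "\<And>t. x t = projected_iterate X \<gamma> x0 (\<lambda>t. G t + \<eta> t *\<^sub>R x t) t"
    and w: "\<And>t. w t = G t - F (x t + z t)"
    and u: "\<And>t. u t = projected_iterate X \<gamma> x0 (\<lambda>t. - w t) t"
  shows "(\<Sum>t<Suc n. \<gamma> t powr r * (F y \<bullet> (x t - y))) \<le>
    \<gamma> n powr (r - 1) * (2 * R)\<^sup>2
    + (\<Sum>t<Suc n. \<gamma> t powr (r + 1) * (2 * (norm (G t))\<^sup>2 + (C\<^sup>2 + H\<^sup>2 * R\<^sup>2)))
    + (\<Sum>t<Suc n. \<gamma> t powr r * (2 * R\<^sup>2 * \<eta> t + 2 * C * eps t))
    - (\<Sum>t<Suc n. \<gamma> t powr r * (w t \<bullet> (x t - u t)))"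
proof -
  have Xne: "X \<noteq> {}" using X by auto
  have xX: "x t \<in> X" for t
    by (subst x) (rule projected_iterate_in[OF X(2) Xne X(3)])
  have eps: "0 \<le> eps t" for t using order_trans[OF norm_ge_zero z(1)] .
  have shift: "v + z t \<in> X + cball 0 \<epsilon>" if "v \<in> X" for v t
    using that z(1)[of t] z(2)[of t] by (intro set_plus_intro) auto
  \<comment> \<open>Index 0 serves only to obtain \<open>0 \<le> \<epsilon>\<close>, so that the
    zero vector lies in the ball.\<close>
  have stay: "v \<in> X + cball 0 \<epsilon>" if "v \<in> X" for v
    using set_plus_intro[OF that, of 0 "cball 0 \<epsilon>"] eps[of 0] z(2)[of 0] by simp
  have C0: "0 \<le> C" using order_trans[OF norm_ge_zero C[OF stay[OF X(3)]]] .
  have R0: "0 \<le> R" using order_trans[OF norm_ge_zero R[OF X(3)]] .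
  have diam: "norm (v - v') \<le> 2 * R" if "v \<in> X" "v' \<in> X" for v v'
    using R[OF that(1)] R[OF that(2)] norm_triangle_ineq4[of v v'] by simp
  \<comment> \<open>The regret bound is used twice: for \<open>x\<close> with the true step
    directions and for \<open>u\<close> with the negated noise. Each carries a factor 1/2, so the
    two diameter terms add up to a single \<open>(2 * R)\<^sup>2\<close>.\<close>
  note reg1 = projected_iterate_regret[where g = "\<lambda>t. G t + \<eta> t *\<^sub>R x t" and D = "2 * R" and n = n and \<gamma> = \<gamma> and r = r,
      OF X(1,2) Xne X(3,4) diam \<gamma> r, unfolded x[symmetric]]
  note reg2 = projected_iterate_regret[where g = "\<lambda>t. - w t" and D = "2 * R" and n = n and \<gamma> = \<gamma> and r = r,
      OF X(1,2) Xne X(3,4) diam \<gamma> r, unfolded u[symmetric]]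
  have sq: "(norm (v + v'))\<^sup>2 \<le> 2 * (norm v)\<^sup>2 + 2 * (norm v')\<^sup>2" for v v' :: 'a
  proof -
    have "(norm (v + v'))\<^sup>2 \<le> (norm v + norm v')\<^sup>2" by (intro power_mono norm_triangle_ineq) simp
    also have "\<dots> \<le> 2 * (norm v)\<^sup>2 + 2 * (norm v')\<^sup>2"
      using sum_squares_bound[of "norm v" "norm v'"] by (simp add: power2_sum)
    finally show ?thesis .
  qed
  \<comment> \<open>Monotonicity between \<open>x t + z t\<close> and \<open>y\<close> replaces
    \<open>F y\<close> by \<open>F (x t + z t) = G t - w t\<close>, up to the pairing with
    \<open>z t\<close>. The noise pairing is then split at \<open>u t\<close>, through
    \<open>x t - y = (x t - u t) + (u t - y)\<close>.\<close>
  have point: "F y \<bullet> (x t - y) \<le> (G t + \<eta> t *\<^sub>R x t) \<bullet> (x t - y) + (- w t) \<bullet> (u t - y)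
      + (2 * R\<^sup>2 * \<eta> t + 2 * C * eps t) - w t \<bullet> (x t - u t)" for t
  proof -
    have "0 \<le> (F (x t + z t) - F y) \<bullet> (x t + z t - y)"
      using mono shift[OF xX] stay[OF X(4)] unfolding monotone_map_on_def by blast
    moreover have "(F (x t + z t) - F y) \<bullet> z t \<le> 2 * C * eps t"
    proof -
      have "(F (x t + z t) - F y) \<bullet> z t \<le> norm (F (x t + z t) - F y) * norm (z t)"
        by (rule norm_cauchy_schwarz)
      also have "\<dots> \<le> (2 * C) * eps t"
        using C[OF shift[OF xX[of t]], of t] C[OF stay[OF X(4)]] z(1)[of t] C0
          norm_triangle_ineq4[of "F (x t + z t)" "F y"]
        by (intro mult_mono) auto
      finally show ?thesis .
    qed
    moreover have "- (x t \<bullet> (x t - y)) \<le> 2 * R\<^sup>2"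
    proof -
      have "- (x t \<bullet> (x t - y)) \<le> norm (x t) * norm (x t - y)"
        using Cauchy_Schwarz_ineq2[of "x t" "x t - y"] by linarith
      also have "\<dots> \<le> R * (2 * R)" using R[OF xX] diam[OF xX X(4)] R0 by (intro mult_mono) auto
      finally show ?thesis by (simp add: power2_eq_square)
    qed
    then have "\<eta> t * (- (x t \<bullet> (x t - y))) \<le> \<eta> t * (2 * R\<^sup>2)"
      by (rule mult_left_mono) (rule \<eta>)
    ultimately show ?thesis
      unfolding w by (simp add: inner_add_left inner_add_right inner_diff_left inner_diff_right algebra_simps)
  qed
  \<comment> \<open>Both squares are split by \<open>sq\<close>. After halving, the two copies of
    \<open>2 * (norm (G t))\<^sup>2\<close> leave one, and \<open>C\<^sup>2\<close> and
    \<open>H\<^sup>2 * R\<^sup>2\<close> keep coefficient 1.\<close>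
  have quad: "((norm (G t + \<eta> t *\<^sub>R x t))\<^sup>2 + (norm (- w t))\<^sup>2) / 2
      \<le> 2 * (norm (G t))\<^sup>2 + (C\<^sup>2 + H\<^sup>2 * R\<^sup>2)" for t
  proof -
    have "(norm (\<eta> t *\<^sub>R x t))\<^sup>2 \<le> H\<^sup>2 * R\<^sup>2"
      unfolding norm_scaleR power_mult_distrib
      using \<eta> R[OF xX] by (intro mult_mono power_mono) auto
    moreover have "(norm (- F (x t + z t)))\<^sup>2 \<le> C\<^sup>2"
      using C[OF shift[OF xX]] by (intro power_mono) auto
    moreover have "norm (- w t) = norm (G t + (- F (x t + z t)))"
      by (simp add: w norm_minus_commute)
    moreover have "(A + B) / 2 \<le> 2 * g + (p + q)"
      if "A \<le> 2 * g + 2 * e" "e \<le> q" "B \<le> 2 * g + 2 * f" "f \<le> p" for A B g e f p q :: real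
      using that by simp
    ultimately show ?thesis
      using sq[of "G t" "\<eta> t *\<^sub>R x t"] sq[of "G t" "- F (x t + z t)"] by (simp only:)
  qed
  have "(\<Sum>t<Suc n. \<gamma> t powr r * (F y \<bullet> (x t - y))) \<le>
    (\<Sum>t<Suc n. \<gamma> t powr r * ((G t + \<eta> t *\<^sub>R x t) \<bullet> (x t - y) + (- w t) \<bullet> (u t - y)
      + (2 * R\<^sup>2 * \<eta> t + 2 * C * eps t) - w t \<bullet> (x t - u t)))"
    by (intro sum_mono mult_left_mono point) simp
  also have "\<dots> = (\<Sum>t<Suc n. \<gamma> t powr r * ((G t + \<eta> t *\<^sub>R x t) \<bullet> (x t - y)))
      + (\<Sum>t<Suc n. \<gamma> t powr r * ((- w t) \<bullet> (u t - y)))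
      + (\<Sum>t<Suc n. \<gamma> t powr r * (2 * R\<^sup>2 * \<eta> t + 2 * C * eps t))
      - (\<Sum>t<Suc n. \<gamma> t powr r * (w t \<bullet> (x t - u t)))"
    by (simp only: distrib_left right_diff_distrib sum.distrib sum_subtractf)
  also have "\<dots> \<le> (\<gamma> n powr (r - 1) * (2 * R)\<^sup>2 + (\<Sum>t<Suc n. \<gamma> t powr (r + 1) * (norm (G t + \<eta> t *\<^sub>R x t))\<^sup>2)) / 2
      + (\<gamma> n powr (r - 1) * (2 * R)\<^sup>2 + (\<Sum>t<Suc n. \<gamma> t powr (r + 1) * (norm (- w t))\<^sup>2)) / 2
      + (\<Sum>t<Suc n. \<gamma> t powr r * (2 * R\<^sup>2 * \<eta> t + 2 * C * eps t))
      - (\<Sum>t<Suc n. \<gamma> t powr r * (w t \<bullet> (x t - u t)))"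
    using reg1 reg2 by (intro diff_mono add_mono) auto
  also have "\<dots> = \<gamma> n powr (r - 1) * (2 * R)\<^sup>2
      + (\<Sum>t<Suc n. \<gamma> t powr (r + 1) * (((norm (G t + \<eta> t *\<^sub>R x t))\<^sup>2 + (norm (- w t))\<^sup>2) / 2))
      + (\<Sum>t<Suc n. \<gamma> t powr r * (2 * R\<^sup>2 * \<eta> t + 2 * C * eps t))
      - (\<Sum>t<Suc n. \<gamma> t powr r * (w t \<bullet> (x t - u t)))"
    by (simp only: distrib_left add_divide_distrib times_divide_eq_right sum.distrib sum_divide_distrib)
  also have "\<dots> \<le> \<gamma> n powr (r - 1) * (2 * R)\<^sup>2
    + (\<Sum>t<Suc n. \<gamma> t powr (r + 1) * (2 * (norm (G t))\<^sup>2 + (C\<^sup>2 + H\<^sup>2 * R\<^sup>2)))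
    + (\<Sum>t<Suc n. \<gamma> t powr r * (2 * R\<^sup>2 * \<eta> t + 2 * C * eps t))
    - (\<Sum>t<Suc n. \<gamma> t powr r * (w t \<bullet> (x t - u t)))"
    by (intro diff_mono add_mono sum_mono mult_left_mono quad order_refl) auto
  finally show ?thesis .
qed

subsection \<open>Independence and conditional means\<close>

lemma (in finite_measure) norm_square_integrable_imp_integrable:
  fixes f :: "'a \<Rightarrow> 'b::{banach, second_countable_topology}"
  assumes [measurable]: "f \<in> borel_measurable M" and "integrable M (\<lambda>x. (norm (f x))\<^sup>2)"
  shows "integrable M f"
  by (rule integrable_norm_cancel, rule square_integrable_imp_integrable) (use assms in auto)

context prob_space
begin

text \<open>In the application \<open>B\<close> is generated by the whole sample sequence,
  \<open>B1\<close> by the earlier samples and \<open>B2\<close> by the current one. Independence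
  inside \<open>B\<close> is combined with that of \<open>B\<close> from \<open>A\<close> and
  \<open>C\<close> on a pi-system of triple intersections.\<close>

lemma indep_set_sigma_join:
  assumes ind: "indep_sets (\<lambda>i. [A, B, C] ! i) {..<3::nat}"
    and sa: "sigma_algebra (space M) A" "sigma_algebra (space M) C"
      "sigma_algebra (space M) B1" "sigma_algebra (space M) B2"
    and sub: "B1 \<subseteq> B" "B2 \<subseteq> B" and ind12: "indep_set B1 B2" and B: "sigma_algebra (space M) B"
  shows "indep_set (sigma_sets (space M) (A \<union> B1 \<union> C)) B2"
proof -
  interpret A: sigma_algebra "space M" A by fact
  interpret C: sigma_algebra "space M" C by fact
  interpret B: sigma_algebra "space M" B by fact
  interpret B1: sigma_algebra "space M" B1 by fact
  interpret B2: sigma_algebra "space M" B2 by fact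
  \<comment> \<open>\<open>G\<close> is stable under intersection and contains \<open>A\<close>,
    \<open>B1\<close> and \<open>C\<close>, by taking the other two factors equal to
    \<open>space M\<close>; hence it generates the joined sigma-algebra.\<close>
  define G where "G = {a \<inter> b \<inter> c | a b c. a \<in> A \<and> b \<in> B1 \<and> c \<in> C}"
  have "\<forall>i\<in>{..<3::nat}. [A, B, C] ! i \<subseteq> events"
    using ind unfolding indep_sets_def by blast
  from bspec[OF this, of 0] bspec[OF this, of 1] bspec[OF this, of 2]
  have ev: "A \<subseteq> events" "B \<subseteq> events" "C \<subseteq> events" by simp_all
  have p3: "prob (a \<inter> b \<inter> c) = prob a * prob b * prob c" if "a \<in> A" "b \<in> B" "c \<in> C" for a b c
  proof -
    have eq: "{..<3::nat} = {0, 1, 2}"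
      by (simp add: numeral_3_eq_3 numeral_2_eq_2 lessThan_Suc insert_commute)
    have "\<forall>j\<in>{..<3::nat}. [a, b, c] ! j \<in> [A, B, C] ! j"
      unfolding eq using that by simp
    from indep_setsD[OF ind subset_refl _ finite_lessThan this]
    show ?thesis unfolding eq by (simp add: Int_assoc mult.assoc)
  qed
  have Gev: "G \<subseteq> events"
    unfolding G_def using subsetD[OF ev(1)] subsetD[OF ev(2)] subsetD[OF ev(3)] subsetD[OF sub(1)]
    by (auto intro!: sets.Int)
  have indG: "indep_set G B2"
  proof (rule indep_setI)
    fix x d assume "x \<in> G" and d: "d \<in> B2"
    then obtain a b c where x: "x = a \<inter> b \<inter> c" "a \<in> A" "b \<in> B1" "c \<in> C" by (auto simp: G_def)
    \<comment> \<open>Keeping \<open>d\<close> together with \<open>b\<close> in the middle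
      sigma-algebra reduces a product of four factors to the threefold formula.\<close>
    have bd: "b \<inter> d \<in> B" using x d sub by (intro B.Int) auto
    have "prob (x \<inter> d) = prob (a \<inter> (b \<inter> d) \<inter> c)" unfolding x by (simp add: Int_ac)
    also have "\<dots> = prob a * (prob b * prob d) * prob c"
      using p3[OF x(2) bd x(4)] indep_setD[OF ind12 x(3) d] by simp
    also have "\<dots> = prob x * prob d"
      using p3[OF x(2) _ x(4), of b] x sub by auto
    finally show "prob (x \<inter> d) = prob x * prob d" .
  qed (use Gev order_trans[OF sub(2) ev(2)] in auto)
  have stG: "Int_stable G"
  proof (rule Int_stableI)
    fix x y assume "x \<in> G" "y \<in> G"
    then obtain a b c a' b' c' where
      x: "x = a \<inter> b \<inter> c" "a \<in> A" "b \<in> B1" "c \<in> C" and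
      y: "y = a' \<inter> b' \<inter> c'" "a' \<in> A" "b' \<in> B1" "c' \<in> C" by (auto simp: G_def)
    have "x \<inter> y = (a \<inter> a') \<inter> (b \<inter> b') \<inter> (c \<inter> c')" unfolding x y by auto
    then show "x \<inter> y \<in> G" unfolding G_def using x y by blast
  qed
  have st2: "Int_stable B2" by (rule Int_stableI) auto
  have "indep_set (sigma_sets (space M) G) (sigma_sets (space M) B2)"
    by (rule indep_set_sigma_sets[OF indG stG st2])
  moreover have "A \<union> B1 \<union> C \<subseteq> G"
  proof -
    have "x \<in> G" if "x \<in> A" for x
      using that A.sets_into_space[of x] unfolding G_def
      by (intro CollectI exI[of _ x] exI[of _ "space M"]) auto
    moreover have "x \<in> G" if "x \<in> B1" for x
      using that B1.sets_into_space[of x] unfolding G_def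
      by (intro CollectI exI[of _ x] exI[of _ "space M"]) auto
    moreover have "x \<in> G" if "x \<in> C" for x
      using that C.sets_into_space[of x] unfolding G_def
      by (intro CollectI exI[of _ x] exI[of _ "space M"]) auto
    ultimately show ?thesis by auto
  qed
  then have "sigma_sets (space M) (A \<union> B1 \<union> C) \<subseteq> sigma_sets (space M) G"
    by (rule sigma_sets_mono')
  ultimately show ?thesis
    by (auto simp: indep_sets2_eq B2.sigma_sets_eq)
qed

text \<open>Both laws are sigma-finite, so the joint law is determined by rectangles, and there
  independence of the preimages is exactly the product formula.\<close>

lemma distr_pair_indep_set:
  assumes [measurable]: "random_variable S X" "random_variable T Y"
    and ind: "indep_set {X -` A \<inter> space M | A. A \<in> sets S} {Y -` A \<inter> space M | A. A \<in> sets T}"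
  shows "distr M (S \<Otimes>\<^sub>M T) (\<lambda>\<omega>. (X \<omega>, Y \<omega>)) = distr M S X \<Otimes>\<^sub>M distr M T Y"
proof (rule pair_measure_eqI[symmetric])
  interpret X: prob_space "distr M S X" by (rule prob_space_distr) fact
  interpret Y: prob_space "distr M T Y" by (rule prob_space_distr) fact
  show "sigma_finite_measure (distr M S X)" "sigma_finite_measure (distr M T Y)" by unfold_locales
  fix A B assume AB: "A \<in> sets (distr M S X)" "B \<in> sets (distr M T Y)"
  then have [measurable]: "A \<in> sets S" "B \<in> sets T" by auto
  have "(\<lambda>\<omega>. (X \<omega>, Y \<omega>)) -` (A \<times> B) \<inter> space M = (X -` A \<inter> space M) \<inter> (Y -` B \<inter> space M)"
    by auto
  moreover have "prob ((X -` A \<inter> space M) \<inter> (Y -` B \<inter> space M)) =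
      prob (X -` A \<inter> space M) * prob (Y -` B \<inter> space M)"
    using AB by (intro indep_setD[OF ind]) auto
  ultimately show "emeasure (distr M S X) A * emeasure (distr M T Y) B =
      emeasure (distr M (S \<Otimes>\<^sub>M T) (\<lambda>\<omega>. (X \<omega>, Y \<omega>))) (A \<times> B)"
    by (simp add: emeasure_distr emeasure_eq_measure ennreal_mult)
qed (simp cong: sets_pair_measure_cong)

text \<open>As \<open>Y\<close> is independent of the pair \<open>(P, V)\<close>, Fubini allows
  integration over \<open>Y\<close> with \<open>P\<close> and \<open>V\<close> held fixed. Second
  moment bounds at fixed points thus carry over to the random point \<open>P\<close>, and the
  centred value of \<open>\<Phi>\<close> is orthogonal to \<open>V\<close>.\<close>

lemma frozen_argument:
  fixes \<Phi> :: "'b::euclidean_space \<Rightarrow> 'c::euclidean_space \<Rightarrow> 'd::euclidean_space"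
    and P :: "'a \<Rightarrow> 'b" and V :: "'a \<Rightarrow> 'd" and Y :: "'a \<Rightarrow> 'c"
  assumes P[measurable]: "P \<in> borel_measurable M" and V[measurable]: "V \<in> borel_measurable M"
    and Y[measurable]: "Y \<in> borel_measurable M"
    and ind: "indep_set {(\<lambda>\<omega>. (P \<omega>, V \<omega>)) -` A \<inter> space M | A. A \<in> sets (borel \<Otimes>\<^sub>M borel)}
      {Y -` A \<inter> space M | A. A \<in> sets borel}"
    and \<Phi>[measurable]: "(\<lambda>(x, u). \<Phi> x u) \<in> borel_measurable (borel \<Otimes>\<^sub>M borel)"
    and PS: "AE \<omega> in M. P \<omega> \<in> S"
    and int: "\<And>x. x \<in> S \<Longrightarrow> integrable (distr M borel Y) (\<lambda>u. (norm (\<Phi> x u))\<^sup>2)"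
    and le: "\<And>x. x \<in> S \<Longrightarrow> (\<integral>u. (norm (\<Phi> x u))\<^sup>2 \<partial>distr M borel Y) \<le> C\<^sup>2"
    and VB: "AE \<omega> in M. norm (V \<omega>) \<le> B"
    and Fb: "\<And>x. x \<in> S \<Longrightarrow> norm (\<integral>u. \<Phi> x u \<partial>distr M borel Y) \<le> C"
  shows "integrable M (\<lambda>\<omega>. (norm (\<Phi> (P \<omega>) (Y \<omega>)))\<^sup>2)"
    and "(\<integral>\<omega>. (norm (\<Phi> (P \<omega>) (Y \<omega>)))\<^sup>2 \<partial>M) \<le> C\<^sup>2"
    and "integrable M (\<lambda>\<omega>. (\<Phi> (P \<omega>) (Y \<omega>) - (\<integral>u. \<Phi> (P \<omega>) u \<partial>distr M borel Y)) \<bullet> V \<omega>)"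
    and "(\<integral>\<omega>. (\<Phi> (P \<omega>) (Y \<omega>) - (\<integral>u. \<Phi> (P \<omega>) u \<partial>distr M borel Y)) \<bullet> V \<omega> \<partial>M) = 0"
proof -
  have [measurable]: "(\<lambda>p. \<Phi> (f p) (h p)) \<in> borel_measurable N"
    if [measurable]: "f \<in> borel_measurable N" "h \<in> borel_measurable N" for N f and h :: "'z \<Rightarrow> 'c"
    using measurable_compose[OF _ \<Phi>, of "\<lambda>p. (f p, h p)" N] by simp
  define N where "N = distr M borel Y"
  define Q where "Q = distr M (borel \<Otimes>\<^sub>M borel) (\<lambda>\<omega>. (P \<omega>, V \<omega>))"
  interpret N: prob_space N unfolding N_def by (rule prob_space_distr) simp
  interpret Q: prob_space Q unfolding Q_def by (rule prob_space_distr) simp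
  interpret QN: pair_prob_space Q N ..
  have [measurable_cong]: "sets N = sets borel" "sets Q = sets (borel \<Otimes>\<^sub>M borel)"
    by (simp_all add: N_def Q_def)
  have joint: "distr M ((borel \<Otimes>\<^sub>M borel) \<Otimes>\<^sub>M borel) (\<lambda>\<omega>. ((P \<omega>, V \<omega>), Y \<omega>)) = Q \<Otimes>\<^sub>M N"
    unfolding Q_def N_def by (rule distr_pair_indep_set[OF _ Y ind]) measurable
  have [measurable]: "(\<lambda>\<omega>. ((P \<omega>, V \<omega>), Y \<omega>)) \<in> M \<rightarrow>\<^sub>M (borel \<Otimes>\<^sub>M borel) \<Otimes>\<^sub>M borel" by measurable
  have cong3: "sets (((borel :: 'b measure) \<Otimes>\<^sub>M (borel :: 'd measure)) \<Otimes>\<^sub>M (borel :: 'c measure)) = sets (Q \<Otimes>\<^sub>M N)"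
    by (intro sets_pair_measure_cong) (simp_all add: N_def Q_def)
  have PSQ: "AE p in Q. fst p \<in> S'" if "AE \<omega> in M. P \<omega> \<in> S'" "S' \<in> sets borel" for S'
  proof -
    have [measurable]: "S' \<in> sets borel" by fact
    show ?thesis
      unfolding Q_def using that(1) by (subst AE_distr_iff) auto
  qed
  define Fb where "Fb x = (\<integral>u. \<Phi> x u \<partial>N)" for x
  have [measurable]: "Fb \<in> borel_measurable borel"
    unfolding Fb_def by (rule N.borel_measurable_lebesgue_integral) measurable
  \<comment> \<open>\<open>S\<close> is not assumed measurable. The bounds valid on it define a
    measurable superset \<open>S'\<close>, which takes over its role on the product space.\<close>
  define S' where "S' = {x. (\<integral>\<^sup>+u. ennreal ((norm (\<Phi> x u))\<^sup>2) \<partial>N) \<le> ennreal (C\<^sup>2) \<and> norm (Fb x) \<le> C}"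
  have S'[measurable]: "S' \<in> sets borel"
  proof -
    have [measurable]: "(\<lambda>x. \<integral>\<^sup>+u. ennreal ((norm (\<Phi> x u))\<^sup>2) \<partial>N) \<in> borel_measurable borel"
      by (rule N.borel_measurable_nn_integral) measurable
    show ?thesis unfolding S'_def by measurable
  qed
  have SS': "S \<subseteq> S'"
  proof
    fix x assume x: "x \<in> S"
    have "(\<integral>\<^sup>+u. ennreal ((norm (\<Phi> x u))\<^sup>2) \<partial>N) = ennreal (\<integral>u. (norm (\<Phi> x u))\<^sup>2 \<partial>N)"
      using int[OF x] by (intro nn_integral_eq_integral) (auto simp: N_def)
    also have "\<dots> \<le> ennreal (C\<^sup>2)" using le[OF x] by (intro ennreal_leI) (simp add: N_def)
    finally show "x \<in> S'" using Fb[OF x] by (simp add: S'_def Fb_def N_def)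
  qed
  have PS': "AE \<omega> in M. P \<omega> \<in> S'" using PS SS' by auto
  have QS': "AE p in Q. fst p \<in> S'" by (rule PSQ[OF PS' S'])
  have sq: "integrable N (\<lambda>u. (norm (\<Phi> x u))\<^sup>2)" if "x \<in> S'" for x
  proof (rule integrableI_bounded)
    show "(\<integral>\<^sup>+u. ennreal (norm ((norm (\<Phi> x u))\<^sup>2)) \<partial>N) < \<infinity>"
      using that by (auto simp: S'_def intro: le_less_trans)
  qed measurable
  have in1: "integrable N (\<Phi> x)" if "x \<in> S'" for x
    by (rule N.norm_square_integrable_imp_integrable[OF _ sq[OF that]]) measurable
  \<comment> \<open>Integrability is still open here, so the moment bound is first derived for the
    nonnegative integral, where Tonelli applies without it.\<close>
  have nn: "(\<integral>\<^sup>+\<omega>. ennreal ((norm (\<Phi> (P \<omega>) (Y \<omega>)))\<^sup>2) \<partial>M) \<le> ennreal (C\<^sup>2)"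
  proof -
    have "(\<integral>\<^sup>+\<omega>. ennreal ((norm (\<Phi> (P \<omega>) (Y \<omega>)))\<^sup>2) \<partial>M) =
        (\<integral>\<^sup>+p. ennreal ((norm (\<Phi> (fst (fst p)) (snd p)))\<^sup>2) \<partial>(Q \<Otimes>\<^sub>M N))"
      unfolding joint[symmetric] by (subst nn_integral_distr) auto
    also have "\<dots> = (\<integral>\<^sup>+p. \<integral>\<^sup>+u. ennreal ((norm (\<Phi> (fst p) u))\<^sup>2) \<partial>N \<partial>Q)"
      by (subst N.nn_integral_fst[symmetric]) auto
    also have "\<dots> \<le> (\<integral>\<^sup>+p. ennreal (C\<^sup>2) \<partial>Q)"
      by (rule nn_integral_mono_AE) (use QS' in \<open>auto simp: S'_def\<close>)
    finally show ?thesis by (simp add: Q.emeasure_space_1)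
  qed
  show i1: "integrable M (\<lambda>\<omega>. (norm (\<Phi> (P \<omega>) (Y \<omega>)))\<^sup>2)"
    by (rule integrableI_bounded) (use nn in \<open>auto intro: le_less_trans\<close>)
  show "(\<integral>\<omega>. (norm (\<Phi> (P \<omega>) (Y \<omega>)))\<^sup>2 \<partial>M) \<le> C\<^sup>2"
    using nn nn_integral_eq_integral[OF i1] by simp
  have i1': "integrable M (\<lambda>\<omega>. \<Phi> (P \<omega>) (Y \<omega>))"
    by (rule norm_square_integrable_imp_integrable[OF _ i1]) measurable
  have i2: "integrable M (\<lambda>\<omega>. (\<Phi> (P \<omega>) (Y \<omega>) - Fb (P \<omega>)) \<bullet> V \<omega>)"
  proof (rule Bochner_Integration.integrable_bound)
    show "integrable M (\<lambda>\<omega>. (norm (\<Phi> (P \<omega>) (Y \<omega>)) + C) * B)"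
      using i1' by auto
    show "AE \<omega> in M. norm ((\<Phi> (P \<omega>) (Y \<omega>) - Fb (P \<omega>)) \<bullet> V \<omega>) \<le> norm ((norm (\<Phi> (P \<omega>) (Y \<omega>)) + C) * B)"
      using VB PS'
    proof eventually_elim
      case (elim \<omega>)
      have "norm (\<Phi> (P \<omega>) (Y \<omega>) - Fb (P \<omega>)) \<le> norm (\<Phi> (P \<omega>) (Y \<omega>)) + C"
        using elim(2) norm_triangle_ineq4[of "\<Phi> (P \<omega>) (Y \<omega>)" "Fb (P \<omega>)"]
        unfolding S'_def mem_Collect_eq by linarith
      moreover from this have "0 \<le> norm (\<Phi> (P \<omega>) (Y \<omega>)) + C"
        by (rule order_trans[OF norm_ge_zero])
      ultimately have "norm (\<Phi> (P \<omega>) (Y \<omega>) - Fb (P \<omega>)) * norm (V \<omega>) \<le> (norm (\<Phi> (P \<omega>) (Y \<omega>)) + C) * B"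
        using elim(1) by (intro mult_mono) auto
      then have "norm ((\<Phi> (P \<omega>) (Y \<omega>) - Fb (P \<omega>)) \<bullet> V \<omega>) \<le> (norm (\<Phi> (P \<omega>) (Y \<omega>)) + C) * B"
        using Cauchy_Schwarz_ineq2[of "\<Phi> (P \<omega>) (Y \<omega>) - Fb (P \<omega>)" "V \<omega>"] by simp
      then show ?case by simp
    qed
  qed measurable
  then show "integrable M (\<lambda>\<omega>. (\<Phi> (P \<omega>) (Y \<omega>) - (\<integral>u. \<Phi> (P \<omega>) u \<partial>distr M borel Y)) \<bullet> V \<omega>)"
    by (simp add: Fb_def N_def)
  let ?h = "\<lambda>p. (\<Phi> (fst (fst p)) (snd p) - Fb (fst (fst p))) \<bullet> snd (fst p)"
  have hm[measurable]: "?h \<in> borel_measurable (Q \<Otimes>\<^sub>M N)" by measurable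
  have hm': "?h \<in> borel_measurable ((borel \<Otimes>\<^sub>M borel) \<Otimes>\<^sub>M borel)"
    using hm measurable_cong_sets[OF cong3 refl] by blast
  have "(\<integral>\<omega>. (\<Phi> (P \<omega>) (Y \<omega>) - Fb (P \<omega>)) \<bullet> V \<omega> \<partial>M) = (\<integral>p. ?h p \<partial>(Q \<Otimes>\<^sub>M N))"
    unfolding joint[symmetric] by (subst integral_distr[OF _ hm']) auto
  also have "\<dots> = (\<integral>p. \<integral>u. ?h (p, u) \<partial>N \<partial>Q)"
  proof (rule QN.integral_fst'[symmetric])
    show "integrable (Q \<Otimes>\<^sub>M N) ?h"
      unfolding joint[symmetric] using i2 by (subst integrable_distr_eq[OF _ hm']) auto
  qed
  also have "\<dots> = (\<integral>p. 0 \<partial>Q)"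
  proof (rule integral_cong_AE)
    \<comment> \<open>With \<open>p\<close> fixed, \<open>snd p\<close> is a constant vector and
      leaves the integral; what remains is the mean of a deviation from the mean.\<close>
    show "AE p in Q. (\<integral>u. ?h (p, u) \<partial>N) = 0"
      using QS'
    proof eventually_elim
      case (elim p)
      have "(\<integral>u. ?h (p, u) \<partial>N) = (\<integral>u. \<Phi> (fst p) u - Fb (fst p) \<partial>N) \<bullet> snd p"
        using in1[OF elim] by simp
      also have "\<dots> = 0" using in1[OF elim] by (simp add: Fb_def N.prob_space)
      finally show ?case .
    qed
  qed measurable
  finally show "(\<integral>\<omega>. (\<Phi> (P \<omega>) (Y \<omega>) - (\<integral>u. \<Phi> (P \<omega>) u \<partial>distr M borel Y)) \<bullet> V \<omega> \<partial>M) = 0"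
    by (simp add: Fb_def N_def)
qed

end

subsection \<open>The stochastic iteration\<close>

lemma borel_measurable_case_prod_compose:
  assumes "(\<lambda>(x, u). \<Phi> x u) \<in> borel_measurable (borel \<Otimes>\<^sub>M borel)"
    and "f \<in> borel_measurable N" "h \<in> borel_measurable N"
  shows "(\<lambda>p. \<Phi> (f p) (h p)) \<in> borel_measurable N"
  using measurable_compose[OF measurable_Pair[OF assms(2,3)] assms(1)] by simp

lemma borel_measurable_closest_point:
  fixes X :: "'a::euclidean_space set"
  assumes "convex X" "closed X" "X \<noteq> {}"
  shows "closest_point X \<in> borel_measurable borel"
  by (rule borel_measurable_continuous_onI[OF continuous_on_closest_point[OF assms]])

text \<open>The measure \<open>N\<close> is arbitrary and only inputs with index below
  \<open>t\<close> must be measurable, so the lemma applies with the past of step \<open>t\<close>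
  in place of \<open>N\<close>.\<close>

lemma measurable_aRSSA_iterate:
  fixes X :: "'a::euclidean_space set" and \<Phi> :: "'a \<Rightarrow> 'b::euclidean_space \<Rightarrow> 'a"
  assumes X: "convex X" "closed X" "X \<noteq> {}"
    and \<Phi>: "(\<lambda>(x, u). \<Phi> x u) \<in> borel_measurable (borel \<Otimes>\<^sub>M borel)"
    and x0: "x0 \<in> borel_measurable N"
    and "\<And>j. j < t \<Longrightarrow> \<xi>s j \<in> borel_measurable N" "\<And>j. j < t \<Longrightarrow> z j \<in> borel_measurable N"
  shows "(\<lambda>\<omega>. aRSSA_iterate X \<Phi> \<gamma> \<eta> (x0 \<omega>) (\<lambda>j. \<xi>s j \<omega>) (\<lambda>i. z i \<omega>) t) \<in> borel_measurable N"
  using assms(6,7)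
proof (induction t)
  case (Suc t)
  have [measurable]: "(\<lambda>\<omega>. aRSSA_iterate X \<Phi> \<gamma> \<eta> (x0 \<omega>) (\<lambda>j. \<xi>s j \<omega>) (\<lambda>i. z i \<omega>) t) \<in> borel_measurable N"
    using Suc by auto
  have [measurable]: "\<xi>s t \<in> borel_measurable N" "z t \<in> borel_measurable N" using Suc.prems by auto
  note [measurable] = borel_measurable_closest_point[OF X] borel_measurable_case_prod_compose[OF \<Phi>]
  show ?case by (simp add: Let_def)
qed (use x0 in simp)

lemma measurable_projected_iterate:
  fixes X :: "'a::euclidean_space set"
  assumes X: "convex X" "closed X" "X \<noteq> {}"
    and x0: "x0 \<in> borel_measurable N"
    and "\<And>j. j < t \<Longrightarrow> (\<lambda>\<omega>. g \<omega> j) \<in> borel_measurable N"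
  shows "(\<lambda>\<omega>. projected_iterate X \<gamma> (x0 \<omega>) (g \<omega>) t) \<in> borel_measurable N"
  using assms(5)
proof (induction t)
  case (Suc t)
  have [measurable]: "(\<lambda>\<omega>. projected_iterate X \<gamma> (x0 \<omega>) (g \<omega>) t) \<in> borel_measurable N"
    "(\<lambda>\<omega>. g \<omega> t) \<in> borel_measurable N"
    using Suc by auto
  note [measurable] = borel_measurable_closest_point[OF X]
  show ?case by simp
qed (use x0 in simp)

section \<open>One run with general step sizes, regularization and perturbation radii\<close>

locale aRSSA_run = prob_space M
  for M :: "'s measure" +
  fixes X :: "'a::euclidean_space set" and \<xi> :: "'s \<Rightarrow> 'b::euclidean_space"
    and \<Phi> :: "'a \<Rightarrow> 'b \<Rightarrow> 'a" and F :: "'a \<Rightarrow> 'a" and C \<epsilon> R H r :: real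
    and \<gamma> \<eta> eps :: "nat \<Rightarrow> real"
    and x0 :: "'s \<Rightarrow> 'a" and \<xi>s :: "nat \<Rightarrow> 's \<Rightarrow> 'b" and z :: "nat \<Rightarrow> 's \<Rightarrow> 'a"
  assumes X: "convex X" "closed X" "X \<noteq> {}"
    and R: "\<And>v. v \<in> X \<Longrightarrow> norm v \<le> R"
    and \<xi>: "\<xi> \<in> borel_measurable M"
    and \<Phi>: "(\<lambda>(x, u). \<Phi> x u) \<in> borel_measurable (borel \<Otimes>\<^sub>M borel)"
    and moment: "\<And>x. x \<in> X + cball 0 \<epsilon> \<Longrightarrow> integrable M (\<lambda>\<omega>. (norm (\<Phi> x (\<xi> \<omega>)))\<^sup>2)"
      "\<And>x. x \<in> X + cball 0 \<epsilon> \<Longrightarrow> (\<integral>\<omega>. (norm (\<Phi> x (\<xi> \<omega>)))\<^sup>2 \<partial>M) \<le> C\<^sup>2"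
    and C: "0 \<le> C"
    and mean: "\<And>x. x \<in> X + cball 0 \<epsilon> \<Longrightarrow> F x = (\<integral>\<omega>. \<Phi> x (\<xi> \<omega>) \<partial>M)"
    and mono: "monotone_map_on (X + cball 0 \<epsilon>) F"
    and \<gamma>: "\<And>n. 0 < \<gamma> n" "\<And>n. \<gamma> (Suc n) \<le> \<gamma> n" and r: "r \<le> 1"
    and \<eta>: "\<And>t. 0 \<le> \<eta> t" "\<And>t. \<eta> t \<le> H"
    and eps: "\<And>t. 0 \<le> eps t" "\<And>t. eps t \<le> \<epsilon>"
    and inputs: "aRSSA_inputs M X \<xi> eps x0 \<xi>s z"
begin

definition iter :: "nat \<Rightarrow> 's \<Rightarrow> 'a" where
  "iter t \<omega> = aRSSA_iterate X \<Phi> \<gamma> \<eta> (x0 \<omega>) (\<lambda>j. \<xi>s j \<omega>) (\<lambda>i. z i \<omega>) t"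

text \<open>\<open>F\<close> is the mean only on the enlarged set; this version is Borel measurable
  on the whole space, which makes the noise a random variable.\<close>

definition mean_map :: "'a \<Rightarrow> 'a" where
  "mean_map x = (\<integral>u. \<Phi> x u \<partial>distr M borel \<xi>)"

definition noise :: "nat \<Rightarrow> 's \<Rightarrow> 'a" where
  "noise t \<omega> = \<Phi> (iter t \<omega> + z t \<omega>) (\<xi>s t \<omega>) - mean_map (iter t \<omega> + z t \<omega>)"

text \<open>Its value at \<open>t\<close> depends on \<open>x0\<close> and on the noise before
  \<open>t\<close> only, hence it is known before the sample at \<open>t\<close> is drawn.\<close>

definition virtual :: "nat \<Rightarrow> 's \<Rightarrow> 'a" where
  "virtual t \<omega> = projected_iterate X \<gamma> (x0 \<omega>) (\<lambda>t. - noise t \<omega>) t"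

text \<open>All perturbations belong to it, also future ones, but only samples before
  \<open>t\<close>. The query point \<open>x + z\<close> of step \<open>t\<close> is thereby known,
  while the sample at \<open>t\<close> stays independent because the perturbations are independent
  of the samples.\<close>

definition past :: "nat \<Rightarrow> 's measure" where
  "past t = sigma (space M) (sets (vimage_algebra (space M) x0 borel)
     \<union> sets (vimage_algebra (space M) (\<lambda>\<omega>. restrict (\<lambda>i. \<xi>s i \<omega>) {..<t}) (PiM {..<t} (\<lambda>_. borel)))
     \<union> sets (vimage_algebra (space M) (\<lambda>\<omega> i. z i \<omega>) (PiM UNIV (\<lambda>_. borel))))"

section \<open>The past of a step and its independence of the current sample\<close>

lemma space_past [simp]: "space (past t) = space M"
  unfolding past_def by (rule space_measure_of) (use sets.sets_into_space in fastforce)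

lemma sets_past: "sets (past t) = sigma_sets (space M) (sets (vimage_algebra (space M) x0 borel)
     \<union> sets (vimage_algebra (space M) (\<lambda>\<omega>. restrict (\<lambda>i. \<xi>s i \<omega>) {..<t}) (PiM {..<t} (\<lambda>_. borel)))
     \<union> sets (vimage_algebra (space M) (\<lambda>\<omega> i. z i \<omega>) (PiM UNIV (\<lambda>_. borel))))"
  unfolding past_def by (rule sets_measure_of) (use sets.sets_into_space in fastforce)

lemma measurable_past:
  assumes "f \<in> vimage_algebra (space M) g N \<rightarrow>\<^sub>M borel"
    and "sets (vimage_algebra (space M) g N) \<subseteq> sets (past t)"
  shows "f \<in> borel_measurable (past t)"
  using assms unfolding measurable_def by (auto simp: subset_iff)

lemma x0_past: "x0 \<in> borel_measurable (past t)"
  by (rule measurable_past[OF measurable_vimage_algebra1]) (auto simp: sets_past)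

lemma sample_past:
  assumes "j < t"
  shows "\<xi>s j \<in> borel_measurable (past t)"
proof (rule measurable_past)
  have "(\<lambda>\<omega>. restrict (\<lambda>i. \<xi>s i \<omega>) {..<t}) \<in>
    vimage_algebra (space M) (\<lambda>\<omega>. restrict (\<lambda>i. \<xi>s i \<omega>) {..<t}) (PiM {..<t} (\<lambda>_. borel)) \<rightarrow>\<^sub>M PiM {..<t} (\<lambda>_. borel)"
    by (rule measurable_vimage_algebra1) (auto simp: space_PiM)
  from measurable_compose[OF this measurable_component_singleton[of j]] assms
  show "\<xi>s j \<in> vimage_algebra (space M) (\<lambda>\<omega>. restrict (\<lambda>i. \<xi>s i \<omega>) {..<t}) (PiM {..<t} (\<lambda>_. borel)) \<rightarrow>\<^sub>M borel"
    by simp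
qed (auto simp: sets_past)

lemma perturbation_past: "z i \<in> borel_measurable (past t)"
proof (rule measurable_past)
  have "(\<lambda>\<omega> i. z i \<omega>) \<in>
    vimage_algebra (space M) (\<lambda>\<omega> i. z i \<omega>) (PiM UNIV (\<lambda>_. borel)) \<rightarrow>\<^sub>M PiM UNIV (\<lambda>_. borel)"
    by (rule measurable_vimage_algebra1) (auto simp: space_PiM)
  from measurable_compose[OF this measurable_component_singleton[of i]]
  show "z i \<in> vimage_algebra (space M) (\<lambda>\<omega> i. z i \<omega>) (PiM UNIV (\<lambda>_. borel)) \<rightarrow>\<^sub>M borel"
    by simp
qed (auto simp: sets_past)

lemma sample_measurable [measurable]: "\<xi>s j \<in> borel_measurable M"
  using inputs by (auto simp: aRSSA_inputs_def indep_vars_def)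

lemma perturbation_measurable [measurable]: "z j \<in> borel_measurable M"
  using inputs by (auto simp: aRSSA_inputs_def indep_vars_def)

lemma x0_measurable [measurable]: "x0 \<in> borel_measurable M"
  using inputs by (auto simp: aRSSA_inputs_def)

text \<open>Disjoint blocks of the independent samples are independent, here \<open>{..<t}\<close>
  and \<open>{t}\<close>. Both generate sub-sigma-algebras of \<open>?B\<close>, so
  \<open>indep_set_sigma_join\<close> adds the starting point and the perturbations to the first
  block.\<close>

lemma past_indep: "indep_set (sets (past t)) {\<xi>s t -` A \<inter> space M | A. A \<in> sets borel}"
proof -
  let ?B = "sets (vimage_algebra (space M) (\<lambda>\<omega> j. \<xi>s j \<omega>) (PiM UNIV (\<lambda>_. borel)))"
  let ?v = "\<lambda>I. vimage_algebra (space M) (\<lambda>\<omega>. restrict (\<lambda>i. \<xi>s i \<omega>) I) (PiM I (\<lambda>_. borel))"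
  have ind: "indep_vars (\<lambda>_. borel) \<xi>s UNIV" using inputs by (simp add: aRSSA_inputs_def)
  have all: "(\<lambda>\<omega> j. \<xi>s j \<omega>) \<in> vimage_algebra (space M) (\<lambda>\<omega> j. \<xi>s j \<omega>) (PiM UNIV (\<lambda>_. borel)) \<rightarrow>\<^sub>M PiM UNIV (\<lambda>_. borel)"
    by (rule measurable_vimage_algebra1) (auto simp: space_PiM)
  have sub: "sets (?v I) \<subseteq> ?B" for I
  proof -
    have "(\<lambda>\<omega>. restrict (\<lambda>i. \<xi>s i \<omega>) I) \<in> vimage_algebra (space M) (\<lambda>\<omega> j. \<xi>s j \<omega>) (PiM UNIV (\<lambda>_. borel)) \<rightarrow>\<^sub>M PiM I (\<lambda>_. borel)"
      by (rule measurable_restrict) (use measurable_compose[OF all measurable_component_singleton] in simp)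
    then show ?thesis
      by (subst sets_vimage_algebra2) (auto simp: space_PiM dest: measurable_sets)
  qed
  have vim: "{(\<lambda>\<omega>. restrict (\<lambda>i. \<xi>s i \<omega>) I) -` A \<inter> space M | A. A \<in> sets (PiM I (\<lambda>_. borel))} = sets (?v I)" for I
    by (subst sets_vimage_algebra2) (auto simp: space_PiM)
  have sig: "sigma_sets (space M) (sets (?v I)) = sets (?v I)" for I
    using sets.sigma_sets_eq[of "?v I"] by simp
  have "indep_var (PiM {..<t} (\<lambda>_. borel)) (\<lambda>\<omega>. restrict (\<lambda>i. \<xi>s i \<omega>) {..<t})
      (PiM {t} (\<lambda>_. borel)) (\<lambda>\<omega>. restrict (\<lambda>i. \<xi>s i \<omega>) {t})"
    by (rule indep_var_restrict[OF ind]) auto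
  then have ind12: "indep_set (sets (?v {..<t})) (sets (?v {t}))"
    by (simp add: indep_var_eq vim sig)
  have sa: "sigma_algebra (space M) (sets (vimage_algebra (space M) f N))" for f :: "'s \<Rightarrow> 'z" and N
    using sets.sigma_algebra_axioms[of "vimage_algebra (space M) f N"] by simp
  have "indep_set (sets (past t)) (sets (?v {t}))"
    unfolding sets_past
    by (rule indep_set_sigma_join[where B = ?B])
      (use inputs ind12 sub in \<open>auto simp: aRSSA_inputs_def intro!: sa\<close>)
  moreover have "{\<xi>s t -` A \<inter> space M | A. A \<in> sets borel} \<subseteq> sets (?v {t})"
  proof -
    have m: "(\<lambda>\<omega>. restrict (\<lambda>i. \<xi>s i \<omega>) {t}) \<in> ?v {t} \<rightarrow>\<^sub>M PiM {t} (\<lambda>_. borel)"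
      by (rule measurable_vimage_algebra1) (auto simp: space_PiM)
    from measurable_compose[OF m measurable_component_singleton[of t]]
    have "\<xi>s t \<in> ?v {t} \<rightarrow>\<^sub>M borel" by simp
    from measurable_sets[OF this] show ?thesis by auto
  qed
  ultimately show ?thesis unfolding indep_sets2_eq by blast
qed

lemma mean_map_measurable [measurable]: "mean_map \<in> borel_measurable borel"
proof -
  interpret N: prob_space "distr M borel \<xi>" by (rule prob_space_distr[OF \<xi>])
  show ?thesis unfolding mean_map_def
    by (rule N.borel_measurable_lebesgue_integral) (use \<Phi> in \<open>simp cong: measurable_cong_sets sets_pair_measure_cong\<close>)
qed

lemma iter_measurable_past: "iter t \<in> borel_measurable (past s)" if "t \<le> s"
  unfolding iter_def using that
  by (intro measurable_aRSSA_iterate X \<Phi> x0_past sample_past perturbation_past) auto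

text \<open>The inequality is strict because the noise at \<open>t\<close> uses the sample at
  \<open>t\<close>, which enters the past only from \<open>Suc t\<close> on.\<close>

lemma noise_measurable_past: "noise t \<in> borel_measurable (past s)" if "t < s"
proof -
  note [measurable] = iter_measurable_past[OF less_imp_le[OF that]] perturbation_past[of t s] sample_past[OF that]
    borel_measurable_case_prod_compose[OF \<Phi>]
  show ?thesis unfolding noise_def by measurable
qed

lemma virtual_measurable_past: "virtual t \<in> borel_measurable (past t)"
  unfolding virtual_def
  by (intro measurable_projected_iterate X x0_past borel_measurable_uminus noise_measurable_past)

lemma past_sub: "sets (past t) \<subseteq> sets M"
  using past_indep[of t] by (rule indep_setD_ev1)

lemma from_past: "f \<in> borel_measurable (past t) \<Longrightarrow> f \<in> borel_measurable M"
  using past_sub[of t] unfolding measurable_def by auto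

lemma iter_measurable [measurable]: "iter t \<in> borel_measurable M"
  by (rule from_past[OF iter_measurable_past[OF order_refl]])

lemma virtual_measurable [measurable]: "virtual t \<in> borel_measurable M"
  by (rule from_past[OF virtual_measurable_past])

section \<open>Almost sure containment, moment bounds and centred noise\<close>

lemma x0_in: "AE \<omega> in M. x0 \<omega> \<in> X"
  using inputs by (simp add: aRSSA_inputs_def)

lemma iter_eq: "iter t \<omega> = projected_iterate X \<gamma> (x0 \<omega>)
    (\<lambda>t. \<Phi> (iter t \<omega> + z t \<omega>) (\<xi>s t \<omega>) + \<eta> t *\<^sub>R iter t \<omega>) t"
  unfolding iter_def by (rule aRSSA_iterate_eq_projected_iterate)

lemma iter_in: "x0 \<omega> \<in> X \<Longrightarrow> iter t \<omega> \<in> X"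
  by (subst iter_eq) (rule projected_iterate_in[OF X(2,3)])

lemma virtual_in: "x0 \<omega> \<in> X \<Longrightarrow> virtual t \<omega> \<in> X"
  unfolding virtual_def by (rule projected_iterate_in[OF X(2,3)])

lemma perturbation_le: "AE \<omega> in M. norm (z t \<omega>) \<le> eps t"
proof -
  have "AE v in distr M borel (z t). norm v \<le> eps t"
  proof -
    have "distr M borel (z t) = uniform_measure lborel (cball 0 (eps t))"
      using inputs by (simp add: aRSSA_inputs_def)
    then show ?thesis by (simp only:) (rule AE_uniform_measureI, auto)
  qed
  then show ?thesis by (subst (asm) AE_distr_iff) auto
qed

lemma mean_map_eq: "mean_map x = F x" if "x \<in> X + cball 0 \<epsilon>"
proof -
  note [measurable] = borel_measurable_case_prod_compose[OF \<Phi>]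
  show ?thesis unfolding mean_map_def mean[OF that] by (rule integral_distr[OF \<xi>]) measurable
qed

text \<open>The norm of the mean is at most the mean of the norm, whose square is at most the second
  moment because a variance is nonnegative.\<close>

lemma F_bound: "norm (F x) \<le> C" if "x \<in> X + cball 0 \<epsilon>"
proof -
  note [measurable] = borel_measurable_case_prod_compose[OF \<Phi>] \<xi>
  have i: "integrable M (\<lambda>\<omega>. \<Phi> x (\<xi> \<omega>))"
    by (rule norm_square_integrable_imp_integrable[OF _ moment(1)[OF that]]) measurable
  have "norm (F x) \<le> (\<integral>\<omega>. norm (\<Phi> x (\<xi> \<omega>)) \<partial>M)" unfolding mean[OF that] by (rule integral_norm_bound)
  moreover have "(\<integral>\<omega>. norm (\<Phi> x (\<xi> \<omega>)) \<partial>M)\<^sup>2 \<le> (\<integral>\<omega>. (norm (\<Phi> x (\<xi> \<omega>)))\<^sup>2 \<partial>M)"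
    using variance_eq[OF integrable_norm[OF i] moment(1)[OF that]]
      variance_positive[of "\<lambda>\<omega>. norm (\<Phi> x (\<xi> \<omega>))"] by linarith
  with moment(2)[OF that] have "(\<integral>\<omega>. norm (\<Phi> x (\<xi> \<omega>)) \<partial>M)\<^sup>2 \<le> C\<^sup>2" by linarith
  then have "(\<integral>\<omega>. norm (\<Phi> x (\<xi> \<omega>)) \<partial>M) \<le> C" using C by (rule power2_le_imp_le)
  ultimately show ?thesis by linarith
qed

lemma query_in: "AE \<omega> in M. iter t \<omega> + z t \<omega> \<in> X + cball 0 \<epsilon>"
  using x0_in perturbation_le[of t]
proof eventually_elim
  case (elim \<omega>)
  then show ?case using eps(2)[of t] by (intro set_plus_intro iter_in) auto
qed

lemma sample_distr: "distr M borel (\<xi>s t) = distr M borel \<xi>"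
  using inputs by (simp add: aRSSA_inputs_def)

text \<open>All four claims are \<open>frozen_argument\<close> for the query point, the difference
  \<open>iter t - virtual t\<close> and the current sample. The first two are measurable in the past
  of \<open>t\<close>, and the difference is bounded by \<open>2 * R\<close> because both sequences
  stay in \<open>X\<close>.\<close>

lemma
  shows gradient_integrable: "integrable M (\<lambda>\<omega>. (norm (\<Phi> (iter t \<omega> + z t \<omega>) (\<xi>s t \<omega>)))\<^sup>2)"
    and gradient_moment: "(\<integral>\<omega>. (norm (\<Phi> (iter t \<omega> + z t \<omega>) (\<xi>s t \<omega>)))\<^sup>2 \<partial>M) \<le> C\<^sup>2"
    and noise_integrable: "integrable M (\<lambda>\<omega>. noise t \<omega> \<bullet> (iter t \<omega> - virtual t \<omega>))"
    and noise_orthogonal: "(\<integral>\<omega>. noise t \<omega> \<bullet> (iter t \<omega> - virtual t \<omega>) \<partial>M) = 0"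
proof -
  let ?P = "\<lambda>\<omega>. iter t \<omega> + z t \<omega>" and ?V = "\<lambda>\<omega>. iter t \<omega> - virtual t \<omega>"
  note [measurable] = borel_measurable_case_prod_compose[OF \<Phi>] \<xi>
  have PV: "(\<lambda>\<omega>. (?P \<omega>, ?V \<omega>)) \<in> past t \<rightarrow>\<^sub>M borel \<Otimes>\<^sub>M borel"
    by (intro measurable_Pair borel_measurable_add borel_measurable_diff iter_measurable_past
        perturbation_past virtual_measurable_past) auto
  have ind: "indep_set {(\<lambda>\<omega>. (?P \<omega>, ?V \<omega>)) -` A \<inter> space M | A. A \<in> sets (borel \<Otimes>\<^sub>M borel)}
      {\<xi>s t -` A \<inter> space M | A. A \<in> sets borel}"
  proof -
    have "{(\<lambda>\<omega>. (?P \<omega>, ?V \<omega>)) -` A \<inter> space M | A. A \<in> sets (borel \<Otimes>\<^sub>M borel)} \<subseteq> sets (past t)"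
      using measurable_sets[OF PV] by auto
    with past_indep[of t] show ?thesis unfolding indep_sets2_eq by blast
  qed
  have VB: "AE \<omega> in M. norm (?V \<omega>) \<le> 2 * R"
    using x0_in
  proof eventually_elim
    case (elim \<omega>)
    show ?case
      using R[OF iter_in[OF elim, of t]] R[OF virtual_in[OF elim, of t]]
        norm_triangle_ineq4[of "iter t \<omega>" "virtual t \<omega>"] by linarith
  qed
  have int: "integrable (distr M borel (\<xi>s t)) (\<lambda>u. (norm (\<Phi> x u))\<^sup>2)"
    "(\<integral>u. (norm (\<Phi> x u))\<^sup>2 \<partial>distr M borel (\<xi>s t)) \<le> C\<^sup>2"
    "norm (\<integral>u. \<Phi> x u \<partial>distr M borel (\<xi>s t)) \<le> C" if "x \<in> X + cball 0 \<epsilon>" for x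
  proof -
    show "integrable (distr M borel (\<xi>s t)) (\<lambda>u. (norm (\<Phi> x u))\<^sup>2)"
      unfolding sample_distr using moment(1)[OF that] by (subst integrable_distr_eq[OF \<xi>]) auto
    show "(\<integral>u. (norm (\<Phi> x u))\<^sup>2 \<partial>distr M borel (\<xi>s t)) \<le> C\<^sup>2"
      unfolding sample_distr using moment(2)[OF that] by (subst integral_distr[OF \<xi>]) auto
    show "norm (\<integral>u. \<Phi> x u \<partial>distr M borel (\<xi>s t)) \<le> C"
      using F_bound[OF that] unfolding sample_distr mean_map_def[symmetric] mean_map_eq[OF that] .
  qed
  have Pm: "?P \<in> borel_measurable M" and Vm: "?V \<in> borel_measurable M" by measurable
  note fa = frozen_argument[OF Pm Vm sample_measurable ind \<Phi> query_in int(1,2) VB int(3)]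
  show "integrable M (\<lambda>\<omega>. (norm (\<Phi> (iter t \<omega> + z t \<omega>) (\<xi>s t \<omega>)))\<^sup>2)"
    "(\<integral>\<omega>. (norm (\<Phi> (iter t \<omega> + z t \<omega>) (\<xi>s t \<omega>)))\<^sup>2 \<partial>M) \<le> C\<^sup>2"
    by (rule fa(1,2); assumption)+
  show "integrable M (\<lambda>\<omega>. noise t \<omega> \<bullet> (iter t \<omega> - virtual t \<omega>))"
    "(\<integral>\<omega>. noise t \<omega> \<bullet> (iter t \<omega> - virtual t \<omega>) \<partial>M) = 0"
    using fa(3,4) unfolding noise_def mean_map_def sample_distr by auto
qed

section \<open>Expected gap of the averaged iterates\<close>

abbreviation xbar :: "nat \<Rightarrow> 's \<Rightarrow> 'a" where
  "xbar \<equiv> aRSSA_average X \<Phi> \<gamma> \<eta> r x0 \<xi>s z"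

lemma xbar_eq: "xbar k \<omega> = weighted_average \<gamma> r (\<lambda>t. iter t \<omega>) k"
  by (simp add: aRSSA_average_def iter_def)

lemma F_bound_X: "y \<in> X \<Longrightarrow> norm (F y) \<le> C"
  using F_bound[of y] set_plus_intro[of y X 0 "cball 0 \<epsilon>"] order_trans[OF eps(1)[of 0] eps(2)[of 0]]
  by simp

lemma weight_pos: "0 < (\<Sum>t<Suc n. \<gamma> t powr r)"
  using \<gamma>(1) by (intro sum_pos) (auto simp: less_imp_neq[symmetric])

lemma gap_xbar_bounds: "AE \<omega> in M. 0 \<le> gap X F (xbar (Suc n) \<omega>) \<and> gap X F (xbar (Suc n) \<omega>) \<le> C * (2 * R)"
  using x0_in
proof eventually_elim
  case (elim \<omega>)
  have "xbar (Suc n) \<omega> \<in> X"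
    unfolding xbar_eq by (rule weighted_average_in[OF X(1) iter_in[OF elim] weight_pos])
  then show ?case using gap_bounds[of X F C R, OF F_bound_X R] by auto
qed

lemma gap_xbar_integrable: "integrable M (\<lambda>\<omega>. gap X F (xbar (Suc n) \<omega>))"
proof (rule integrable_const_bound)
  have [measurable]: "gap X F \<in> borel_measurable borel"
    by (rule borel_measurable_continuous_onI[OF lipschitz_on_continuous_on])
      (rule gap_lipschitz[OF X(3) F_bound_X R])
  show "(\<lambda>\<omega>. gap X F (xbar (Suc n) \<omega>)) \<in> borel_measurable M"
    unfolding xbar_eq weighted_average_def by measurable
  show "AE \<omega> in M. norm (gap X F (xbar (Suc n) \<omega>)) \<le> C * (2 * R)"
    using gap_xbar_bounds[of n] by eventually_elim simp
qed

lemma expected_gap_nonneg: "0 \<le> (\<integral>\<omega>. gap X F (xbar (Suc n) \<omega>) \<partial>M)"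
  by (rule integral_nonneg_AE) (use gap_xbar_bounds[of n] in auto)

text \<open>The pathwise bound is free of the comparison point, so it bounds the gap itself almost
  surely. Taking expectations removes the noise pairing and replaces the squared samples by
  \<open>C\<^sup>2\<close>.\<close>

lemma expected_gap_le:
  "(\<integral>\<omega>. gap X F (xbar (Suc n) \<omega>) \<partial>M) \<le>
    ((2 * R)\<^sup>2 * \<gamma> n powr (r - 1) + (3 * C\<^sup>2 + H\<^sup>2 * R\<^sup>2) * (\<Sum>t<Suc n. \<gamma> t powr (r + 1))
     + (\<Sum>t<Suc n. \<gamma> t powr r * (2 * R\<^sup>2 * \<eta> t + 2 * C * eps t))) / (\<Sum>t<Suc n. \<gamma> t powr r)"
proof -
  let ?W = "\<Sum>t<Suc n. \<gamma> t powr r"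
  let ?G = "\<lambda>t \<omega>. \<Phi> (iter t \<omega> + z t \<omega>) (\<xi>s t \<omega>)"
  let ?S = "\<Sum>t<Suc n. \<gamma> t powr r * (2 * R\<^sup>2 * \<eta> t + 2 * C * eps t)"
  let ?B = "\<lambda>\<omega>. \<gamma> n powr (r - 1) * (2 * R)\<^sup>2
    + (\<Sum>t<Suc n. \<gamma> t powr (r + 1) * (2 * (norm (?G t \<omega>))\<^sup>2 + (C\<^sup>2 + H\<^sup>2 * R\<^sup>2))) + ?S
    - (\<Sum>t<Suc n. \<gamma> t powr r * (noise t \<omega> \<bullet> (iter t \<omega> - virtual t \<omega>)))"
  \<comment> \<open>The index set is countable, so a single null set serves all steps; outside it
    the regret inequality holds for every \<open>y\<close> at once.\<close>
  have "AE \<omega> in M. \<forall>t. norm (z t \<omega>) \<le> eps t \<and> iter t \<omega> + z t \<omega> \<in> X + cball 0 \<epsilon>"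
    unfolding AE_all_countable using perturbation_le query_in by auto
  then have path: "AE \<omega> in M. gap X F (xbar (Suc n) \<omega>) \<le> ?B \<omega> / ?W"
    using x0_in
  proof eventually_elim
    case (elim \<omega>)
    show ?case
      unfolding xbar_eq
    proof (rule gap_weighted_average_le[OF X(3) weight_pos])
      fix y assume "y \<in> X"
      show "(\<Sum>t<Suc n. \<gamma> t powr r * (F y \<bullet> (iter t \<omega> - y))) \<le> ?B \<omega>"
      proof (rule pathwise_regret[where z = "\<lambda>t. z t \<omega>"
            and x = "\<lambda>t. iter t \<omega>" and w = "\<lambda>t. noise t \<omega>" and u = "\<lambda>t. virtual t \<omega>" and G = "\<lambda>t. ?G t \<omega>"
            and eps = eps and \<epsilon> = \<epsilon> and F = F and C = C and R = R and H = H and \<gamma> = \<gamma> and r = r and \<eta> = \<eta>,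
            OF X(1,2) elim(2) \<open>y \<in> X\<close> R F_bound mono \<gamma> r \<eta>])
        show "norm (z t \<omega>) \<le> eps t" "eps t \<le> \<epsilon>" for t using elim(1) eps by auto
        show "noise t \<omega> = ?G t \<omega> - F (iter t \<omega> + z t \<omega>)" for t
          using elim(1) by (simp add: noise_def mean_map_eq)
        show "iter t \<omega> = projected_iterate X \<gamma> (x0 \<omega>) (\<lambda>t. ?G t \<omega> + \<eta> t *\<^sub>R iter t \<omega>) t" for t
          by (rule iter_eq)
      qed (auto simp: virtual_def)
    qed
  qed
  have G: "has_bochner_integral M (\<lambda>\<omega>. (norm (?G t \<omega>))\<^sup>2) (\<integral>\<omega>. (norm (?G t \<omega>))\<^sup>2 \<partial>M)" for t
    by (rule has_bochner_integral_integrable[OF gradient_integrable])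
  have N: "has_bochner_integral M (\<lambda>\<omega>. noise t \<omega> \<bullet> (iter t \<omega> - virtual t \<omega>)) 0" for t
    using noise_integrable noise_orthogonal by (simp add: has_bochner_integral_iff)
  have const: "has_bochner_integral M (\<lambda>\<omega>. c) c" for c :: real
    by (simp add: has_bochner_integral_iff prob_space)
  \<comment> \<open>Working with \<open>has_bochner_integral\<close> yields integrability of the
    bound and the value of its integral together; the 0 is the mean of the noise pairing.\<close>
  have B: "has_bochner_integral M (\<lambda>\<omega>. ?B \<omega> / ?W) ((\<gamma> n powr (r - 1) * (2 * R)\<^sup>2
    + (\<Sum>t<Suc n. \<gamma> t powr (r + 1) * (2 * (\<integral>\<omega>. (norm (?G t \<omega>))\<^sup>2 \<partial>M) + (C\<^sup>2 + H\<^sup>2 * R\<^sup>2))) + ?S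
    - (\<Sum>t<Suc n. \<gamma> t powr r * 0)) / ?W)"
    by (intro has_bochner_integral_divide has_bochner_integral_diff has_bochner_integral_add
        has_bochner_integral_sum has_bochner_integral_mult_right G N const)
  have "(\<integral>\<omega>. gap X F (xbar (Suc n) \<omega>) \<partial>M) \<le> (\<integral>\<omega>. ?B \<omega> / ?W \<partial>M)"
    by (rule integral_mono_AE[OF gap_xbar_integrable integrable.intros[OF B] path])
  also have "\<dots> = (\<gamma> n powr (r - 1) * (2 * R)\<^sup>2
    + (\<Sum>t<Suc n. \<gamma> t powr (r + 1) * (2 * (\<integral>\<omega>. (norm (?G t \<omega>))\<^sup>2 \<partial>M) + (C\<^sup>2 + H\<^sup>2 * R\<^sup>2))) + ?S) / ?W"
    unfolding has_bochner_integral_integral_eq[OF B] by (simp only: mult_zero_right sum.neutral_const diff_zero)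
  also have "\<dots> \<le> (\<gamma> n powr (r - 1) * (2 * R)\<^sup>2
    + (\<Sum>t<Suc n. \<gamma> t powr (r + 1) * (2 * C\<^sup>2 + (C\<^sup>2 + H\<^sup>2 * R\<^sup>2))) + ?S) / ?W"
  proof (rule divide_right_mono[OF add_right_mono[OF add_left_mono[OF sum_mono]]])
    show "\<gamma> t powr (r + 1) * (2 * (\<integral>\<omega>. (norm (?G t \<omega>))\<^sup>2 \<partial>M) + (C\<^sup>2 + H\<^sup>2 * R\<^sup>2))
        \<le> \<gamma> t powr (r + 1) * (2 * C\<^sup>2 + (C\<^sup>2 + H\<^sup>2 * R\<^sup>2))" for t
      using gradient_moment[of t] by (intro mult_left_mono) auto
  qed (use weight_pos[of n] in simp)
  also have "(\<Sum>t<Suc n. \<gamma> t powr (r + 1) * (2 * C\<^sup>2 + (C\<^sup>2 + H\<^sup>2 * R\<^sup>2))) =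
      (3 * C\<^sup>2 + H\<^sup>2 * R\<^sup>2) * (\<Sum>t<Suc n. \<gamma> t powr (r + 1))"
    unfolding sum_distrib_right[symmetric] by (subst mult.commute) simp
  also have "\<gamma> n powr (r - 1) * (2 * R)\<^sup>2 = (2 * R)\<^sup>2 * \<gamma> n powr (r - 1)"
    by (rule mult.commute)
  finally show ?thesis .
qed

end

subsection \<open>Convergence rates\<close>

text \<open>By the mean value theorem each increment of \<open>s powr (1 - p)\<close> is
  \<open>(1 - p)\<close> times a value of \<open>s powr - p\<close>, and the increments telescope.
  This gives one of the two bounds; the other compares every summand with the last one. Which is
  which depends on the sign of \<open>p\<close>, and negative \<open>p\<close> does occur because
  \<open>r\<close> may be negative.\<close>

lemma sum_powr_bounds:
  assumes "p < (1::real)"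
  obtains c C where "0 < c" "0 < C"
    "\<And>n. c * real n powr (1 - p) \<le> (\<Sum>t<n. (real t + 1) powr - p)"
    "\<And>n. (\<Sum>t<n. (real t + 1) powr - p) \<le> C * real n powr (1 - p)"
proof -
  define q where "q = 1 - p"
  have q: "q > 0" using assms by (simp add: q_def)
  have mvt: "\<exists>s. real t < s \<and> s < real t + 1 \<and> (real t + 1) powr q - real t powr q = q * s powr - p" for t
  proof -
    have c: "continuous_on {real t..real t + 1} (\<lambda>s. s powr q)"
      using q by (intro continuous_on_powr') (auto intro!: continuous_intros)
    have d: "((\<lambda>s. s powr q) has_real_derivative q * s powr (q - 1)) (at s)"
      if "real t < s" "s < real t + 1" for s
      using that by (auto intro!: derivative_eq_intros)
    have "\<exists>l s. real t < s \<and> s < real t + 1 \<and> ((\<lambda>s. s powr q) has_real_derivative l) (at s) \<and>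
        (real t + 1) powr q - real t powr q = ((real t + 1) - real t) * l"
      by (rule MVT[OF _ c]) (use d in \<open>auto simp: real_differentiable_def\<close>)
    then obtain l s where s: "real t < s" "s < real t + 1"
        "((\<lambda>s. s powr q) has_real_derivative l) (at s)" "(real t + 1) powr q - real t powr q = l"
      by auto
    have "l = q * s powr (q - 1)" by (rule DERIV_unique[OF s(3) d[OF s(1,2)]])
    with s show ?thesis by (auto simp: q_def)
  qed
  have tele: "(\<Sum>t<n. (real t + 1) powr q - real t powr q) = real n powr q" for n
    by (induction n) (simp_all add: add.commute)
  have "\<exists>c C. 0 < c \<and> 0 < C \<and> (\<forall>n. c * real n powr q \<le> (\<Sum>t<n. (real t + 1) powr - p)) \<and>
     (\<forall>n. (\<Sum>t<n. (real t + 1) powr - p) \<le> C * real n powr q)"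
  proof (cases "p \<ge> 0")
    \<comment> \<open>The summands decrease here: the telescoping sum bounds from above with
      constant \<open>1 / q\<close>, the last summand from below with constant 1. The other case
      exchanges the roles.\<close>
    case True
    have "(\<Sum>t<n. (real t + 1) powr - p) \<le> (1 / q) * real n powr q" for n
    proof -
      have "(real t + 1) powr - p \<le> (1 / q) * ((real t + 1) powr q - real t powr q)" for t
      proof -
        obtain s where s: "real t < s" "s < real t + 1"
          "(real t + 1) powr q - real t powr q = q * s powr - p" using mvt by blast
        have "(real t + 1) powr - p \<le> s powr - p"
          using True s by (intro powr_mono2') auto
        with s(3) q show ?thesis by simp
      qed
      then have "(\<Sum>t<n. (real t + 1) powr - p) \<le> (\<Sum>t<n. (1 / q) * ((real t + 1) powr q - real t powr q))"
        by (intro sum_mono)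
      then show ?thesis using tele[of n] by (simp add: sum_divide_distrib[symmetric])
    qed
    moreover have "1 * real n powr q \<le> (\<Sum>t<n. (real t + 1) powr - p)" for n
    proof (cases "n = 0")
      case False
      have "real n powr q = (\<Sum>t<n. real n powr - p)"
        using False powr_add[of "real n" 1 "-p"] by (simp add: q_def)
      also have "\<dots> \<le> (\<Sum>t<n. (real t + 1) powr - p)"
        using True by (intro sum_mono powr_mono2') auto
      finally show ?thesis by simp
    qed simp
    ultimately show ?thesis using q by (intro exI[of _ 1] exI[of _ "1/q"]) auto
  next
    case False
    have "(1 / q) * real n powr q \<le> (\<Sum>t<n. (real t + 1) powr - p)" for n
    proof -
      have "(1 / q) * ((real t + 1) powr q - real t powr q) \<le> (real t + 1) powr - p" for t
      proof -
        obtain s where s: "real t < s" "s < real t + 1"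
          "(real t + 1) powr q - real t powr q = q * s powr - p" using mvt by blast
        have "s powr - p \<le> (real t + 1) powr - p"
          using False s by (intro powr_mono2) auto
        with s(3) q show ?thesis by simp
      qed
      then have "(\<Sum>t<n. (1 / q) * ((real t + 1) powr q - real t powr q)) \<le> (\<Sum>t<n. (real t + 1) powr - p)"
        by (intro sum_mono)
      then show ?thesis using tele[of n] by (simp add: sum_divide_distrib[symmetric])
    qed
    moreover have "(\<Sum>t<n. (real t + 1) powr - p) \<le> 1 * real n powr q" for n
    proof (cases "n = 0")
      case F: False
      have "(\<Sum>t<n. (real t + 1) powr - p) \<le> (\<Sum>t<n. real n powr - p)"
        using False by (intro sum_mono powr_mono2) auto
      also have "\<dots> = real n powr q"
        using F powr_add[of "real n" 1 "-p"] by (simp add: q_def)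
      finally show ?thesis by simp
    qed simp
    ultimately show ?thesis using q by (intro exI[of _ 1] exI[of _ "1/q"]) auto
  qed
  with that show ?thesis unfolding q_def by blast
qed

lemma power_seq_powr:
  assumes "s > 0"
  shows "power_seq s p t powr q = s powr q * (real t + 1) powr - (p * q)"
  using assms by (simp add: power_seq_def powr_mult powr_powr)

text \<open>Coarsening the exponent to a common \<open>e\<close> lets error terms of different
  orders be added.\<close>

lemma sum_powr_le:
  assumes "p < (1::real)" "1 - p \<le> e"
  obtains C where "0 < C" "\<And>n. (\<Sum>t<n. (real t + 1) powr - p) \<le> C * real n powr e"
proof -
  obtain C where C: "0 < C" "\<And>n. (\<Sum>t<n. (real t + 1) powr - p) \<le> C * real n powr (1 - p)"
    using sum_powr_bounds[OF assms(1)] by metis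
  have "C * real n powr (1 - p) \<le> C * real n powr e" for n
    using C(1) assms(2) by (cases "n = 0") (auto intro!: mult_left_mono powr_mono)
  with C show ?thesis using that order_trans by blast
qed

text \<open>The denominator grows at least like \<open>k powr (1 - a * r)\<close>. The four
  conditions on \<open>q\<close> make the last weight, the quadratic terms, the regularization and
  the smoothing, in this order, smaller by a factor of order \<open>k powr - q\<close>.\<close>

lemma ergodic_bound_rate:
  assumes pos: "0 < \<gamma>0" "0 \<le> A" "0 \<le> B" "0 \<le> E" "0 \<le> G" "0 \<le> \<eta>0" "0 \<le> \<epsilon>0"
    and p: "a * r + a < 1" "a * r + b < 1" "a * r + c < 1" "0 < a"
    and q: "q \<le> 1 - a" "q \<le> a" "q \<le> b" "q \<le> c"
  shows "(\<lambda>k. (A * power_seq \<gamma>0 a (k - 1) powr (r - 1) + B * (\<Sum>t<k. power_seq \<gamma>0 a t powr (r + 1))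
      + (\<Sum>t<k. power_seq \<gamma>0 a t powr r * (E * power_seq \<eta>0 b t + G * power_seq \<epsilon>0 c t)))
      / (\<Sum>t<k. power_seq \<gamma>0 a t powr r)) \<in> O(\<lambda>k. real k powr - q)"
proof -
  \<comment> \<open>This is the growth allowed to the numerator: divided by
    \<open>k powr (1 - a * r)\<close> it leaves \<open>k powr - q\<close>.\<close>
  define e where "e = 1 - a * r - q"
  obtain C1 where C1: "0 < C1" "\<And>n. (\<Sum>t<n. (real t + 1) powr - (a * r + a)) \<le> C1 * real n powr e"
    by (rule sum_powr_le[of "a * r + a" e]) (use p q e_def in auto)
  obtain C2 where C2: "0 < C2" "\<And>n. (\<Sum>t<n. (real t + 1) powr - (a * r + b)) \<le> C2 * real n powr e"
    by (rule sum_powr_le[of "a * r + b" e]) (use p q e_def in auto)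
  obtain C3 where C3: "0 < C3" "\<And>n. (\<Sum>t<n. (real t + 1) powr - (a * r + c)) \<le> C3 * real n powr e"
    by (rule sum_powr_le[of "a * r + c" e]) (use p q e_def in auto)
  obtain c0 where c0: "0 < c0" "\<And>n. c0 * real n powr (1 - a * r) \<le> (\<Sum>t<n. (real t + 1) powr - (a * r))"
    using sum_powr_bounds[of "a * r"] p by (metis add_less_cancel_right less_add_same_cancel1 order_less_trans)
  define K where "K = A * \<gamma>0 powr (r - 1) + B * (\<gamma>0 powr (r + 1) * C1) +
    \<gamma>0 powr r * ((E * \<eta>0) * C2 + (G * \<epsilon>0) * C3)"
  have K: "0 \<le> K" unfolding K_def using pos C1(1) C2(1) C3(1) by simp
  show ?thesis
  proof (rule bigoI[of _ "K / (\<gamma>0 powr r * c0)"], rule eventually_sequentiallyI[of 1])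
    fix k :: nat assume k: "1 \<le> k"
    let ?N = "A * power_seq \<gamma>0 a (k - 1) powr (r - 1) + B * (\<Sum>t<k. power_seq \<gamma>0 a t powr (r + 1))
      + (\<Sum>t<k. power_seq \<gamma>0 a t powr r * (E * power_seq \<eta>0 b t + G * power_seq \<epsilon>0 c t))"
    let ?W = "\<Sum>t<k. power_seq \<gamma>0 a t powr r"
    have n1: "A * power_seq \<gamma>0 a (k - 1) powr (r - 1) \<le> A * \<gamma>0 powr (r - 1) * real k powr e"
    proof -
      \<comment> \<open>\<open>power_seq\<close> shifts its index by one, so the weight of the last
        summand \<open>k - 1\<close> is a power of \<open>k\<close> itself.\<close>
      have "real (k - 1) + 1 = real k" using k by simp
      then have "power_seq \<gamma>0 a (k - 1) powr (r - 1) = \<gamma>0 powr (r - 1) * real k powr (a - a * r)"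
        unfolding power_seq_powr[OF pos(1)] by (simp add: algebra_simps)
      also have "\<dots> \<le> \<gamma>0 powr (r - 1) * real k powr e"
        using k q by (intro mult_left_mono powr_mono) (auto simp: e_def)
      finally show ?thesis using pos(2) by (simp add: mult_left_mono mult.assoc)
    qed
    have n2: "B * (\<Sum>t<k. power_seq \<gamma>0 a t powr (r + 1)) \<le> B * (\<gamma>0 powr (r + 1) * C1) * real k powr e"
    proof -
      have "(\<Sum>t<k. power_seq \<gamma>0 a t powr (r + 1)) = \<gamma>0 powr (r + 1) * (\<Sum>t<k. (real t + 1) powr - (a * r + a))"
        unfolding power_seq_powr[OF pos(1)] sum_distrib_left by (simp add: algebra_simps)
      also have "\<dots> \<le> \<gamma>0 powr (r + 1) * (C1 * real k powr e)"
        by (intro mult_left_mono C1(2)) simp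
      finally show ?thesis using pos(3) by (simp add: mult_left_mono mult.assoc)
    qed
    have n3: "(\<Sum>t<k. power_seq \<gamma>0 a t powr r * (E * power_seq \<eta>0 b t + G * power_seq \<epsilon>0 c t))
       \<le> \<gamma>0 powr r * ((E * \<eta>0) * C2 + (G * \<epsilon>0) * C3) * real k powr e"
    proof -
      have "(\<Sum>t<k. power_seq \<gamma>0 a t powr r * (E * power_seq \<eta>0 b t + G * power_seq \<epsilon>0 c t)) =
        \<gamma>0 powr r * (E * \<eta>0 * (\<Sum>t<k. (real t + 1) powr - (a * r + b)) +
          G * \<epsilon>0 * (\<Sum>t<k. (real t + 1) powr - (a * r + c)))"
      proof -
        have "(real t + 1) powr - (a * r + s) = (real t + 1) powr - (a * r) * (real t + 1) powr - s" for t s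
          by (subst powr_add[symmetric]) simp
        then show ?thesis
          unfolding power_seq_powr[OF pos(1)] sum_distrib_left
          by (simp add: power_seq_def sum.distrib[symmetric] sum_distrib_left algebra_simps)
      qed
      also have "\<dots> \<le> \<gamma>0 powr r * ((E * \<eta>0) * (C2 * real k powr e) + (G * \<epsilon>0) * (C3 * real k powr e))"
        by (intro mult_left_mono add_mono C2(2) C3(2)) (use pos in auto)
      finally show ?thesis by (simp add: algebra_simps)
    qed
    have num: "?N \<le> K * real k powr e"
      using n1 n2 n3 unfolding K_def by (simp add: algebra_simps)
    have den: "\<gamma>0 powr r * c0 * real k powr (1 - a * r) \<le> ?W"
      unfolding power_seq_powr[OF pos(1)] sum_distrib_left[symmetric] mult.assoc
      by (intro mult_left_mono c0(2)) simp
    have d0: "0 < \<gamma>0 powr r * c0 * real k powr (1 - a * r)" using pos(1) c0(1) k by simp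
    show "norm (?N / ?W) \<le> K / (\<gamma>0 powr r * c0) * norm (real k powr - q)"
    proof -
      have "0 \<le> ?N" using pos
        by (intro add_nonneg_nonneg mult_nonneg_nonneg sum_nonneg) (auto simp: power_seq_def)
      then have "norm (?N / ?W) = ?N / ?W" using den d0 by simp
      also have "\<dots> \<le> K * real k powr e / (\<gamma>0 powr r * c0 * real k powr (1 - a * r))"
        by (intro frac_le num den d0 mult_nonneg_nonneg K) simp
      also have "\<dots> = K / (\<gamma>0 powr r * c0) * (real k powr e / real k powr (1 - a * r))" by simp
      also have "real k powr e / real k powr (1 - a * r) = real k powr - q"
        unfolding e_def by (subst powr_diff[symmetric]) simp
      finally show ?thesis by simp
    qed
  qed
qed

section \<open>Power sequences and the choice of exponents\<close>

lemma power_seq_mono: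
  assumes "0 < s" "0 < p"
  shows "0 < power_seq s p n" "power_seq s p (Suc n) \<le> power_seq s p n" "power_seq s p n \<le> s"
proof -
  have "(real n + 1) powr - p \<le> 1 powr - p" "(real (Suc n) + 1) powr - p \<le> (real n + 1) powr - p"
    using assms by (intro powr_mono2'; simp)+
  with assms show "0 < power_seq s p n" "power_seq s p (Suc n) \<le> power_seq s p n" "power_seq s p n \<le> s"
    by (auto simp: power_seq_def mult_le_cancel_left1)
qed

theorem proposition6:
  fixes M :: "'s measure"
    and X :: "(real ^ 'n) set"
    and \<xi> :: "'s \<Rightarrow> real ^ 'd"
    and \<Phi> :: "real ^ 'n \<Rightarrow> real ^ 'd \<Rightarrow> real ^ 'n"
    and F :: "real ^ 'n \<Rightarrow> real ^ 'n"
    and C \<epsilon> \<gamma>0 \<eta>0 \<epsilon>0 :: real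
    and tstar :: "real ^ 'n"
  assumes "prob_space M"
    and "closed X" and "bounded X" and "convex X"
    and "\<xi> \<in> borel_measurable M"
    and "(\<lambda>(x, u). \<Phi> x u) \<in> borel_measurable (borel \<Otimes>\<^sub>M borel)"
    and "\<gamma>0 > 0" and "\<eta>0 > 0" and "\<epsilon>0 > 0" and "\<epsilon>0 \<le> \<epsilon>"
    and "C > 0"
    and "\<forall>x \<in> X + cball 0 \<epsilon>. integrable M (\<lambda>\<omega>. (norm (\<Phi> x (\<xi> \<omega>)))\<^sup>2) \<and>
           (\<integral>\<omega>. (norm (\<Phi> x (\<xi> \<omega>)))\<^sup>2 \<partial>M) \<le> C\<^sup>2"
    and "\<forall>x \<in> X + cball 0 \<epsilon>. F x = (\<integral>\<omega>. \<Phi> x (\<xi> \<omega>) \<partial>M)"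
    and "monotone_map_on (X + cball 0 \<epsilon>) F"
    and "continuous_on (X + cball 0 \<epsilon>) F"
    and "VI_solutions X F \<noteq> {}"
    and "is_arg_min norm (\<lambda>t. t \<in> VI_solutions X F) tstar"
    and "F differentiable (at tstar)"
    and "\<exists>U. open U \<and> tstar \<in> U \<and> (\<forall>x\<in>U. F differentiable (at x)) \<and>
           bounded ((\<lambda>x. jacobian F (at x)) ` U)"
  shows
    "(\<forall>\<delta>. 0 < \<delta> \<and> \<delta> < 1/6 \<longrightarrow>
       (\<exists>a b c r. a > 0 \<and> b > 0 \<and> c > 0 \<and> a > 0.5 \<and> a + 3 * b < 1 \<and> b + 2 * c < a \<and>
          b < c \<and> r \<le> 1 / a \<and>
          (\<forall>x0 \<xi>s z. aRSSA_inputs M X \<xi> (power_seq \<epsilon>0 c) x0 \<xi>s z \<longrightarrow>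
             (let xbar = aRSSA_average X \<Phi> (power_seq \<gamma>0 a) (power_seq \<eta>0 b) r x0 \<xi>s z in
                (\<forall>k>0. integrable M (\<lambda>\<omega>. gap X F (xbar k \<omega>))) \<and>
                (\<lambda>k. \<integral>\<omega>. gap X F (xbar k \<omega>) \<partial>M) \<in> O(\<lambda>k. real k powr (- (1/6 - \<delta>)))))))
     \<and>
     (\<forall>\<delta> \<delta>' a b c r. 0 < \<delta> \<and> \<delta> < 1/6 \<and> 0 < \<delta>' \<and> \<delta>' < \<delta> \<and>
          a = 0.5 + 3 * (\<delta> - \<delta>') \<and> b = 1/6 - \<delta> \<and> c = 1/6 \<and>
          r < (0.5 - 3 * (\<delta> - \<delta>')) / (0.5 + 3 * (\<delta> - \<delta>')) \<longrightarrow>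
          (\<forall>x0 \<xi>s z. aRSSA_inputs M X \<xi> (power_seq \<epsilon>0 c) x0 \<xi>s z \<longrightarrow>
             (let xbar = aRSSA_average X \<Phi> (power_seq \<gamma>0 a) (power_seq \<eta>0 b) r x0 \<xi>s z in
                (\<forall>k>0. integrable M (\<lambda>\<omega>. gap X F (xbar k \<omega>))) \<and>
                (\<lambda>k. \<integral>\<omega>. gap X F (xbar k \<omega>) \<partial>M) \<longlonglongrightarrow> 0 \<and>
                (\<lambda>k. \<integral>\<omega>. gap X F (xbar k \<omega>) \<partial>M) \<in> O(\<lambda>k. real k powr (- (1/6 - \<delta>))))))"
proof -
  \<comment> \<open>This is the second, explicit claim for one choice of parameters and inputs; the
    existence claim is a special case of it.\<close>
  have main: "(\<forall>k>0. integrable M (\<lambda>\<omega>. gap X F (xbar k \<omega>))) \<and>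
      (\<lambda>k. \<integral>\<omega>. gap X F (xbar k \<omega>) \<partial>M) \<longlonglongrightarrow> 0 \<and>
      (\<lambda>k. \<integral>\<omega>. gap X F (xbar k \<omega>) \<partial>M) \<in> O(\<lambda>k. real k powr (- (1/6 - \<delta>)))"
    if \<delta>: "0 < \<delta>" "\<delta> < 1/6" "0 < \<delta>'" "\<delta>' < \<delta>"
      and abc: "a = 0.5 + 3 * (\<delta> - \<delta>')" "b = 1/6 - \<delta>" "c = 1/6"
      and r: "r < (0.5 - 3 * (\<delta> - \<delta>')) / (0.5 + 3 * (\<delta> - \<delta>'))"
      and inputs: "aRSSA_inputs M X \<xi> (power_seq \<epsilon>0 c) x0 \<xi>s z"
      and xbar: "xbar = aRSSA_average X \<Phi> (power_seq \<gamma>0 a) (power_seq \<eta>0 b) r x0 \<xi>s z"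
    for \<delta> \<delta>' a b c r x0 \<xi>s z and xbar :: "nat \<Rightarrow> 's \<Rightarrow> real ^ 'n"
  proof -
    have pos: "0 < a" "0 < b" "0 < c" using \<delta> abc by simp_all
    \<comment> \<open>The threshold for \<open>r\<close> is \<open>(1 - a) / a\<close>, so the
      hypothesis on \<open>r\<close> says exactly that \<open>a * r + a < 1\<close>.\<close>
    have "1 - a = 0.5 - 3 * (\<delta> - \<delta>')" by (simp add: abc)
    with r have "r < (1 - a) / a" by (simp only: abc)
    then have ar: "a * r + a < 1" using pos by (simp add: field_simps)
    \<comment> \<open>Since \<open>a\<close> exceeds 1/2, the bound \<open>a * r < 1 - a\<close>
      lies below \<open>a\<close>, which forces \<open>r < 1\<close> as the regret bound
      requires.\<close>
    have "1 < 2 * a" using \<delta> by (simp add: abc)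
    with ar have "a * r < a * 1" by linarith
    then have r1: "r < 1" using pos(1) by simp
    obtain R where R: "\<And>v. v \<in> X \<Longrightarrow> norm v \<le> R"
      using \<open>bounded X\<close> unfolding bounded_iff by blast
    have "X \<noteq> {}" using \<open>VI_solutions X F \<noteq> {}\<close> unfolding VI_solutions_def by blast
    note ps = power_seq_mono[OF \<open>\<gamma>0 > 0\<close> pos(1)] power_seq_mono[OF \<open>\<eta>0 > 0\<close> pos(2)]
      power_seq_mono[OF \<open>\<epsilon>0 > 0\<close> pos(3)]
    interpret prob_space M by fact
    interpret aRSSA_run M X \<xi> \<Phi> F C \<epsilon> R \<eta>0 r "power_seq \<gamma>0 a" "power_seq \<eta>0 b" "power_seq \<epsilon>0 c" x0 \<xi>s z
    proof
      show "power_seq \<epsilon>0 c t \<le> \<epsilon>" for t using ps(9)[of t] \<open>\<epsilon>0 \<le> \<epsilon>\<close> by linarith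
    qed (use assms \<open>X \<noteq> {}\<close> R ps inputs r1 in \<open>auto intro: less_imp_le\<close>)
    let ?E = "\<lambda>k. \<integral>\<omega>. gap X F (xbar k \<omega>) \<partial>M"
    let ?B = "\<lambda>k. ((2 * R)\<^sup>2 * power_seq \<gamma>0 a (k - 1) powr (r - 1)
      + (3 * C\<^sup>2 + \<eta>0\<^sup>2 * R\<^sup>2) * (\<Sum>t<k. power_seq \<gamma>0 a t powr (r + 1))
      + (\<Sum>t<k. power_seq \<gamma>0 a t powr r * (2 * R\<^sup>2 * power_seq \<eta>0 b t + 2 * C * power_seq \<epsilon>0 c t)))
      / (\<Sum>t<k. power_seq \<gamma>0 a t powr r)"
    have int: "integrable M (\<lambda>\<omega>. gap X F (xbar k \<omega>))" if "k > 0" for k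
      using gap_xbar_integrable[of "k - 1"] that by (simp add: xbar)
    have "norm (?E k) \<le> norm (?B k)" if "1 \<le> k" for k
    proof -
      \<comment> \<open>The estimates of a run are stated for averages of index
        \<open>Suc n\<close>, so they are read at \<open>n = k - 1\<close> with \<open>k\<close>
        positive.\<close>
      have "Suc (k - 1) = k" using that by simp
      with expected_gap_le[of "k - 1"] expected_gap_nonneg[of "k - 1"]
      have "0 \<le> ?E k" "?E k \<le> ?B k" unfolding xbar by simp_all
      then show ?thesis unfolding real_norm_def by linarith
    qed
    then have "?E \<in> O(?B)"
      by (intro landau_o.big_mono eventually_sequentiallyI[of 1])
    also have "?B \<in> O(\<lambda>k. real k powr - (1/6 - \<delta>))"
      \<comment> \<open>The rate is \<open>q = b\<close>. The remaining conditions hold because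
        \<open>b\<close> and \<open>c\<close> lie below \<open>a\<close>, \<open>b\<close> lies
        below \<open>c\<close>, and \<open>\<delta> < 1/6\<close> gives
        \<open>1/6 - \<delta> \<le> 1 - a\<close>.\<close>
      by (rule ergodic_bound_rate) (use assms ar \<delta> pos in \<open>simp_all add: abc\<close>)
    finally have O: "?E \<in> O(\<lambda>k. real k powr - (1/6 - \<delta>))" .
    then obtain K where K: "eventually (\<lambda>k. norm (?E k) \<le> K * norm (real k powr - (1/6 - \<delta>))) sequentially"
      by (auto elim: landau_o.bigE)
    have "(\<lambda>k. real k powr - (1/6 - \<delta>)) \<longlonglongrightarrow> 0"
      using \<delta> by (intro tendsto_neg_powr filterlim_real_sequentially) simp
    then have "?E \<longlonglongrightarrow> 0"
      by (rule tendsto_0_le) (use K in \<open>simp add: mult.commute\<close>)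
    with O int show ?thesis by blast
  qed
  show ?thesis
  proof (intro conjI allI impI)
    fix \<delta> :: real
    assume \<delta>: "0 < \<delta> \<and> \<delta> < 1/6"
    \<comment> \<open>The witnesses are \<open>\<delta>' = \<delta> / 2\<close> and
      \<open>r = 0\<close>; the latter is admissible because the threshold is positive for
      \<open>\<delta> < 1/6\<close>.\<close>
    then have r: "(0::real) < (0.5 - 3 * (\<delta> - \<delta> / 2)) / (0.5 + 3 * (\<delta> - \<delta> / 2))"
      by (intro divide_pos_pos) auto
    show "\<exists>a b c r. a > 0 \<and> b > 0 \<and> c > 0 \<and> a > 0.5 \<and> a + 3 * b < 1 \<and> b + 2 * c < a \<and>
          b < c \<and> r \<le> 1 / a \<and>
          (\<forall>x0 \<xi>s z. aRSSA_inputs M X \<xi> (power_seq \<epsilon>0 c) x0 \<xi>s z \<longrightarrow>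
             (let xbar = aRSSA_average X \<Phi> (power_seq \<gamma>0 a) (power_seq \<eta>0 b) r x0 \<xi>s z in
                (\<forall>k>0. integrable M (\<lambda>\<omega>. gap X F (xbar k \<omega>))) \<and>
                (\<lambda>k. \<integral>\<omega>. gap X F (xbar k \<omega>) \<partial>M) \<in> O(\<lambda>k. real k powr (- (1/6 - \<delta>)))))"
      unfolding Let_def
      by (rule exI[of _ "0.5 + 3 * (\<delta> - \<delta> / 2)"], rule exI[of _ "1/6 - \<delta>"], rule exI[of _ "1/6"],
          rule exI[of _ 0])
        (use \<delta> main[OF _ _ _ _ refl refl refl r _ refl] in auto)
  next
    fix \<delta> \<delta>' a b c r :: real and x0 \<xi>s z
    assume "0 < \<delta> \<and> \<delta> < 1/6 \<and> 0 < \<delta>' \<and> \<delta>' < \<delta> \<and>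
        a = 0.5 + 3 * (\<delta> - \<delta>') \<and> b = 1/6 - \<delta> \<and> c = 1/6 \<and>
        r < (0.5 - 3 * (\<delta> - \<delta>')) / (0.5 + 3 * (\<delta> - \<delta>'))"
      and "aRSSA_inputs M X \<xi> (power_seq \<epsilon>0 c) x0 \<xi>s z"
    then show "let xbar = aRSSA_average X \<Phi> (power_seq \<gamma>0 a) (power_seq \<eta>0 b) r x0 \<xi>s z in
        (\<forall>k>0. integrable M (\<lambda>\<omega>. gap X F (xbar k \<omega>))) \<and>
        (\<lambda>k. \<integral>\<omega>. gap X F (xbar k \<omega>) \<partial>M) \<longlonglongrightarrow> 0 \<and>
        (\<lambda>k. \<integral>\<omega>. gap X F (xbar k \<omega>) \<partial>M) \<in> O(\<lambda>k. real k powr (- (1/6 - \<delta>)))"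
      unfolding Let_def by (elim conjE) (rule main[OF _ _ _ _ _ _ _ _ _ refl], assumption+)
  qed
qed

end
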